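(* Consider the dual risk model described in the context, with parameters $\lambda,\mu>0$, $a\ge 0$, $c\in(0,1)$, $\theta\in[-1,1]$, $\bar c=1-c$. Let $\tau_x$ be the time to ruin from initial surplus $x$, $T(s,x)=E(e^{-s\tau_x})$ its Laplace–Stieltjes transform (LST), and $\tau(s,\beta)=\int_0^\infty e^{-\beta x}T(s,x)\,dx$. Put $r(s,\beta)=\frac{\beta+cs}{\bar c}$, $\psi(s,\beta)=\frac{r(s,\beta)}{1+a}=\frac{\beta+cs}{\bar c(1+a)}$, and let $\psi^{(0)}(s,\beta)=\beta$, $\psi^{(j)}(s,\beta)=\psi(s,\psi^{(j-1)}(s,\beta))$, i.e. $\psi^{(j)}(s,\beta)=\frac{\beta}{(\bar c(1+a))^{j}}+\sum_{i=1}^{j}\frac{cs}{(\bar c(1+a))^{i}}$, $j=1,2,\dots$. Define $$\tilde J(s,\beta;\theta)=\frac{\lambda\mu\big[(s+2\lambda\bar c+\beta)(2\mu(1+a)-r(s,\beta))-\theta(s+\beta)r(s,\beta)\big]}{(s+2\lambda\bar c+\beta)(2\mu(1+a)-r(s,\beta))(s+\lambda\bar c+\beta)(\mu(1+a)-r(s,\beta))},$$ $$\tilde H(s,\beta;\theta)=\frac{1}{s+\lambda\bar c+\beta}\left(1-\lambda\mu\left[\frac{(s+\beta)(1-\theta)+2\lambda\bar c}{(s+2\lambda\bar c+\beta)(\mu(1+a)-r(s,\beta))}\tau(s,\mu)+\frac{2\theta(s+\beta)}{(s+2\lambda\bar c+\beta)(2\mu(1+a)-r(s,\beta))}\tau(s,2\mu)\right]\right).$$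 Then the Laplace transform of the ruin time LST $T(s,x)$ is given by $$\tau(s,\beta)=\sum_{k=0}^{\infty}\Big(\prod_{j=0}^{k-1}\tilde J(s,\psi^{(j)}(s,\beta);\theta)\Big)\tilde H(s,\psi^{(k)}(s,\beta);\theta),$$ an empty product being $1$. The unknowns $\tau(s,\mu)$ and $\tau(s,2\mu)$ (which appear with a prefactor in all $\tilde H(s,\psi^{(k)}(s,\beta);\theta)$) are derived from the system of equations that is constructed by substituting $\beta=\mu$ and $\beta=2\mu$ in this identity.
   Context: Model. The surplus starts at $x>0$ and decreases at unit rate between gains. If the surplus is at level $x$ (initially or right after a gain), then the time until the next gain is $cx+B$, where $c\in(0,1)$. If the surplus just before the gain is $u$, it jumps up to $(1+a)u+C$, with $C$ the gain size. The pairs $(B,C)$ used at successive gains are i.i.d.; marginally $B\sim\exp(\lambda)$ and $C\sim\exp(\mu)$, and they are dependent through the Farlie–Gumbel–Morgenstern copula with parameter $\theta\in[-1,1]$, i.e. with joint density $$f_{B,C}(t,y)=\lambda e^{-\lambda t}\mu e^{-\mu y}+\theta(2\lambda e^{-2\lambda t}-\lambda e^{-\lambda t})(2\mu e^{-2\mu y}-\mu e^{-\mu y}),\qquad t,y\ge 0.$$ The time to ruin $\tau_x$ is the first time the surplus hits $0$ ($\tau_x=\infty$ if this never happens, with $e^{-s\infty}=0$). Thus $$T(s,x)=e^{-sx}e^{-\lambda(1-c)x}+\int_{t=cx}^{x}e^{-st}\int_{y=0}^{\infty}T(s,(1+a)(x-t)+y)f_{B,C}(t-cx,y)\,dy\,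dt.$$
   Formalization: Added: no ψ^(j)(s,β), j≥1, equals μ or 2μ (zero denominator); and if the ψ^(j) converge, lim|J̃|<1 or some J̃ factor is 0 (else the series can diverge, e.g. λ=μ=1, a=2, c=1/2, θ=0, s=0.9, β=2). Re s≥0, Re(s+β)>0; unknowns are unique if the system's determinant is nonzero. *)

theory Defs
  imports "HOL-Probability.Probability"
begin

definition fgm_density :: "real \<Rightarrow> real \<Rightarrow> real \<Rightarrow> real \<times> real \<Rightarrow> real" where
  "fgm_density lam mu theta = (\<lambda>(t, y).
     if 0 \<le> t \<and> 0 \<le> y
     then lam * exp (- lam * t) * (mu * exp (- mu * y))
        + theta * (2 * lam * exp (- 2 * lam * t) - lam * exp (- lam * t))
                * (2 * mu * exp (- 2 * mu * y) - mu * exp (- mu * y))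
     else 0)"

text \<open>
  One path of the surplus process is driven by two real sequences: \<open>B n\<close> and \<open>C n\<close> belong to
  the gain number \<open>n + 1\<close>. The level right after the \<open>n\<close>-th gain is \<open>level n\<close> (with
  \<open>level 0 = x\<close>), and \<open>epoch n\<close> is the time of that gain. The recursion is not stopped at ruin, so
  \<open>level\<close>, \<open>epoch\<close> and \<open>surplus\<close> have a meaning only up to the first zero of \<open>surplus\<close>;
  almost surely the infimum in \<open>ruin_time\<close> does not depend on what happens afterwards. The
  infimum of the empty set is \<open>\<infinity>\<close>.
\<close>

primrec level :: "real \<Rightarrow> real \<Rightarrow> (nat \<Rightarrow> real) \<Rightarrow> (nat \<Rightarrow> real) \<Rightarrow> real \<Rightarrow> nat \<Rightarrow> real" where
  "level a c B C x 0 = x"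
| "level a c B C x (Suc n) =
     (1 + a) * (level a c B C x n - (c * level a c B C x n + B n)) + C n"

primrec epoch :: "real \<Rightarrow> real \<Rightarrow> (nat \<Rightarrow> real) \<Rightarrow> (nat \<Rightarrow> real) \<Rightarrow> real \<Rightarrow> nat \<Rightarrow> real" where
  "epoch a c B C x 0 = 0"
| "epoch a c B C x (Suc n) = epoch a c B C x n + (c * level a c B C x n + B n)"

definition surplus :: "real \<Rightarrow> real \<Rightarrow> (nat \<Rightarrow> real) \<Rightarrow> (nat \<Rightarrow> real) \<Rightarrow> real \<Rightarrow> real \<Rightarrow> real" where
  "surplus a c B C x t =
     (let n = (LEAST n. t < epoch a c B C x (Suc n))
      in level a c B C x n - (t - epoch a c B C x n))"

definition ruin_time :: "real \<Rightarrow> real \<Rightarrow> (nat \<Rightarrow> real) \<Rightarrow> (nat \<Rightarrow> real) \<Rightarrow> real \<Rightarrow> ereal" where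
  "ruin_time a c B C x = Inf {ereal t | t. 0 \<le> t \<and> surplus a c B C x t = 0}"

definition discount :: "complex \<Rightarrow> ereal \<Rightarrow> complex" where
  "discount s t = (if t = \<infinity> then 0 else exp (- s * of_real (real_of_ereal t)))"

definition ruin_lst ::
  "'w measure \<Rightarrow> (nat \<Rightarrow> 'w \<Rightarrow> real) \<Rightarrow> (nat \<Rightarrow> 'w \<Rightarrow> real) \<Rightarrow> real \<Rightarrow> real \<Rightarrow> complex \<Rightarrow> real \<Rightarrow> complex"
  where
  "ruin_lst M B C a c s x =
     (LINT w|M. discount s (ruin_time a c (\<lambda>n. B n w) (\<lambda>n. C n w) x))"

text \<open>
  Ruin takes at least time \<open>x\<close>, hence \<open>norm (ruin_lst M B C a c s x) \<le> exp (- Re s * x)\<close> for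
  \<open>Re s \<ge> 0\<close>, and the integral below converges absolutely whenever \<open>Re (s + beta) > 0\<close>.
\<close>

definition ruin_tau ::
  "'w measure \<Rightarrow> (nat \<Rightarrow> 'w \<Rightarrow> real) \<Rightarrow> (nat \<Rightarrow> 'w \<Rightarrow> real) \<Rightarrow> real \<Rightarrow> real \<Rightarrow> complex \<Rightarrow> complex \<Rightarrow> complex"
  where
  "ruin_tau M B C a c s beta =
     (LINT x:{0<..}|lborel. exp (- beta * of_real x) * ruin_lst M B C a c s x)"

definition rr :: "real \<Rightarrow> complex \<Rightarrow> complex \<Rightarrow> complex" where
  "rr c s beta = (beta + of_real c * s) / of_real (1 - c)"

definition psi :: "real \<Rightarrow> real \<Rightarrow> complex \<Rightarrow> complex \<Rightarrow> complex" where
  "psi a c s beta = rr c s beta / of_real (1 + a)"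

definition psi_iter :: "real \<Rightarrow> real \<Rightarrow> complex \<Rightarrow> nat \<Rightarrow> complex \<Rightarrow> complex" where
  "psi_iter a c s j beta = (psi a c s ^^ j) beta"

lemma psi_iter_closed_form:
  "psi_iter a c s j beta =
     beta / of_real ((1 - c) * (1 + a)) ^ j
       + (\<Sum>i=1..j. of_real c * s / of_real ((1 - c) * (1 + a)) ^ i)"
proof (induction j)
  case 0
  then show ?case by (simp add: psi_iter_def)
next
  case (Suc j)
  let ?k = "of_real ((1 - c) * (1 + a)) :: complex"
  have "(\<Sum>i=1..Suc j. of_real c * s / ?k ^ i)
      = of_real c * s / ?k + (\<Sum>i=1..j. of_real c * s / ?k ^ i) / ?k"
    unfolding One_nat_def sum.atLeast_Suc_atMost_Suc_shift
    by (subst sum.atLeast_Suc_atMost) (auto simp: sum_divide_distrib sum.atLeast1_atMost_eq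
        lessThan_Suc_atMost mult.commute field_simps)
  moreover have "psi_iter a c s (Suc j) beta = (psi_iter a c s j beta + of_real c * s) / ?k"
    by (simp add: psi_iter_def psi_def rr_def)
  ultimately show ?case
    by (simp add: Suc add_divide_distrib mult.commute)
qed

definition J_tilde ::
  "real \<Rightarrow> real \<Rightarrow> real \<Rightarrow> real \<Rightarrow> real \<Rightarrow> complex \<Rightarrow> complex \<Rightarrow> complex" where
  "J_tilde lam mu a c theta s beta =
     of_real (lam * mu)
       * ((s + of_real (2 * lam * (1 - c)) + beta) * (of_real (2 * mu * (1 + a)) - rr c s beta)
          - of_real theta * (s + beta) * rr c s beta)
     / ((s + of_real (2 * lam * (1 - c)) + beta) * (of_real (2 * mu * (1 + a)) - rr c s beta)
        * (s + of_real (lam * (1 - c)) + beta) * (of_real (mu * (1 + a)) - rr c s beta))"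

text \<open>
  The arguments \<open>u\<close> and \<open>v\<close> stand for the two unknowns, the values of the transform at \<open>mu\<close> and
  \<open>2 * mu\<close>. Keeping them as arguments allows the linear system for them to be stated.
\<close>

definition H_tilde ::
  "real \<Rightarrow> real \<Rightarrow> real \<Rightarrow> real \<Rightarrow> real \<Rightarrow> complex \<Rightarrow> complex \<Rightarrow> complex \<Rightarrow> complex \<Rightarrow> complex" where
  "H_tilde lam mu a c theta u v s beta =
     1 / (s + of_real (lam * (1 - c)) + beta)
       * (1 - of_real (lam * mu)
            * (((s + beta) * of_real (1 - theta) + of_real (2 * lam * (1 - c)))
                 / ((s + of_real (2 * lam * (1 - c)) + beta) * (of_real (mu * (1 + a)) - rr c s beta))
                 * u
               + 2 * of_real theta * (s + beta)
                 / ((s + of_real (2 * lam * (1 - c)) + beta) * (of_real (2 * mu * (1 + a)) - rr c s beta))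
                 * v))"

definition series_term ::
  "real \<Rightarrow> real \<Rightarrow> real \<Rightarrow> real \<Rightarrow> real \<Rightarrow> complex \<Rightarrow> complex \<Rightarrow> complex \<Rightarrow> complex \<Rightarrow> nat \<Rightarrow> complex" where
  "series_term lam mu a c theta u v s beta k =
     (\<Prod>j<k. J_tilde lam mu a c theta s (psi_iter a c s j beta))
       * H_tilde lam mu a c theta u v s (psi_iter a c s k beta)"

text \<open>
  The series at \<open>(s, beta)\<close> makes sense when no denominator \<open>mu * (1 + a) - rr c s b\<close> or
  \<open>2 * mu * (1 + a) - rr c s b\<close> vanishes at an iterate \<open>b\<close>, i.e. when no later iterate equals \<open>mu\<close>
  or \<open>2 * mu\<close>.
\<close>

definition no_pole :: "real \<Rightarrow> real \<Rightarrow> real \<Rightarrow> complex \<Rightarrow> complex \<Rightarrow> bool" where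
  "no_pole mu a c s beta \<longleftrightarrow>
     (\<forall>j\<ge>1. psi_iter a c s j beta \<noteq> of_real mu \<and> psi_iter a c s j beta \<noteq> of_real (2 * mu))"

text \<open>
  For \<open>Re s \<ge> 0\<close> and \<open>Re (s + beta) > 0\<close> the iterates tend to infinity if \<open>(1 - c) * (1 + a) < 1\<close>,
  or if \<open>(1 - c) * (1 + a) = 1\<close> and \<open>s \<noteq> 0\<close>; there the factors \<open>J_tilde\<close> tend to zero and
  \<open>factors_contract\<close> holds vacuously. If \<open>(1 - c) * (1 + a) > 1\<close> the iterates tend to the fixed point
  \<open>b = c * s / ((1 - c) * (1 + a) - 1)\<close> of \<open>psi\<close>, and the terms behave geometrically with ratio
  \<open>J_tilde\<close> at \<open>b\<close>, which can exceed 1 in modulus: for \<open>lam = mu = 1\<close>, \<open>a = 2\<close>, \<open>c = 1/2\<close>,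
  \<open>theta = 0\<close>, \<open>s = 0.9\<close> the ratio is \<open>1 / 0.69\<close> and the series diverges. The first disjunct covers
  a series with finitely many nonzero terms.
\<close>

definition factors_contract ::
  "real \<Rightarrow> real \<Rightarrow> real \<Rightarrow> real \<Rightarrow> real \<Rightarrow> complex \<Rightarrow> complex \<Rightarrow> bool" where
  "factors_contract lam mu a c theta s beta \<longleftrightarrow>
     (\<exists>j. J_tilde lam mu a c theta s (psi_iter a c s j beta) = 0)
     \<or> (convergent (\<lambda>j. psi_iter a c s j beta) \<longrightarrow>
         (\<exists>l<1. (\<lambda>j. norm (J_tilde lam mu a c theta s (psi_iter a c s j beta))) \<longlonglongrightarrow> l))"

definition series_sum ::
  "real \<Rightarrow> real \<Rightarrow> real \<Rightarrow> real \<Rightarrow> real \<Rightarrow> complex \<Rightarrow> complex \<Rightarrow> complex \<Rightarrow> complex \<Rightarrow> complex" where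
  "series_sum lam mu a c theta u v s beta = (\<Sum>k. series_term lam mu a c theta u v s beta k)"

text \<open>
  \<open>series_sum\<close> is affine in \<open>(u, v)\<close>, so \<open>u = series_sum \<dots> u v s mu\<close>,
  \<open>v = series_sum \<dots> u v s (2 * mu)\<close> is a linear system for \<open>(u, v)\<close>. The differences
  \<open>du\<close> and \<open>dv\<close> below are its coefficients, and \<open>system_det\<close> is its determinant.
\<close>

definition system_det ::
  "real \<Rightarrow> real \<Rightarrow> real \<Rightarrow> real \<Rightarrow> real \<Rightarrow> complex \<Rightarrow> complex" where
  "system_det lam mu a c theta s =
     (let F = (\<lambda>u v b. series_sum lam mu a c theta u v s b);
          du = (\<lambda>b. F 1 0 b - F 0 0 b);
          dv = (\<lambda>b. F 0 1 b - F 0 0 b);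
          p = of_real mu; q = of_real (2 * mu)
      in (1 - du p) * (1 - dv q) - dv p * du q)"

end

theory Submission
  imports Defs
begin

text \<open>
  Conditioning on the first gain gives the renewal equation for \<open>T(s, x)\<close>. The density of the
  Farlie-Gumbel-Morgenstern copula is a combination of four products of exponential densities, and
  for each product the integral term is a convolution of an exponential with the function
  \<open>v \<mapsto> E T(s, (1 + a) v + Y)\<close>, where \<open>Y\<close> is exponential. Taking Laplace transforms
  yields \<open>\<tau>(\<beta>) = J(\<beta>) \<tau>(\<psi>(\<beta>)) + H(\<beta>)\<close>, which is iterated. The remainder vanishes since
  \<open>\<tau>\<close> is bounded along the iterates and, unless one of the factors \<open>J\<close> is 0, they are eventually bounded by some \<open>r < 1\<close>:
  either the iterates tend to infinity, where \<open>J\<close> tends to 0, or they converge and the assumption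
  on the factors applies.
\<close>

section \<open>Paths of the surplus process\<close>

text \<open>\<open>ruin_time\<close> refers to the whole unstopped path, so it has no recursion in
  the first gain. \<open>stopped_discount\<close> has one. It is studied on the canonical space of
  gain sequences, where splitting off the first gain is a product decomposition, and on almost every
  path it tends to the discount at ruin.

  The arguments \<open>rr\<close> and \<open>psi\<close> come from two changes of scale. A gap
  surplus \<open>b\<close> leaves the level \<open>(1 - c) * x - b\<close> before the gain, so the
  renewal integral is a convolution evaluated at \<open>(1 - c) * x\<close>; the factor
  \<open>1 + a\<close> of the jump rescales once more. Averaging over an exponential gain of rate
  \<open>m\<close> produces the difference of the transforms at \<open>psi\<close> and at
  \<open>m\<close>, divided by a multiple of \<open>m - psi\<close>. This is the origin both of the
  two unknowns and of the poles excluded by \<open>no_pole\<close>.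

  For the linear system, convergence of the series is not enough: its constant part and the parts
  multiplying each unknown have to be summable separately, even if the iterates come close to
  \<open>mu\<close> or \<open>2 * mu\<close>, where single coefficients of \<open>H_tilde\<close>
  may be large.\<close>

abbreviation path_level :: "real \<Rightarrow> real \<Rightarrow> real \<Rightarrow> (nat \<Rightarrow> real \<times> real) \<Rightarrow> nat \<Rightarrow> real" where
  "path_level a c x w \<equiv> level a c (\<lambda>n. fst (w n)) (\<lambda>n. snd (w n)) x"

abbreviation path_epoch :: "real \<Rightarrow> real \<Rightarrow> real \<Rightarrow> (nat \<Rightarrow> real \<times> real) \<Rightarrow> nat \<Rightarrow> real" where
  "path_epoch a c x w \<equiv> epoch a c (\<lambda>n. fst (w n)) (\<lambda>n. snd (w n)) x"

abbreviation path_ruin_time :: "real \<Rightarrow> real \<Rightarrow> real \<Rightarrow> (nat \<Rightarrow> real \<times> real) \<Rightarrow> ereal" where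
  "path_ruin_time a c x w \<equiv> ruin_time a c (\<lambda>n. fst (w n)) (\<lambda>n. snd (w n)) x"

definition next_level :: "real \<Rightarrow> real \<Rightarrow> real \<Rightarrow> real \<times> real \<Rightarrow> real" where
  "next_level a c x z = (1 + a) * ((1 - c) * x - fst z) + snd z"

text \<open>The discount factor at ruin if ruin occurs before gain number \<open>n\<close>, and 0 otherwise.\<close>

primrec stopped_discount ::
  "real \<Rightarrow> real \<Rightarrow> complex \<Rightarrow> nat \<Rightarrow> real \<Rightarrow> (nat \<Rightarrow> real \<times> real) \<Rightarrow> complex" where
  "stopped_discount a c s 0 x w = 0"
| "stopped_discount a c s (Suc n) x w =
     (if (1 - c) * x \<le> fst (w 0) then exp (- s * of_real x)
      else exp (- s * of_real (c * x + fst (w 0)))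
           * stopped_discount a c s n (next_level a c x (w 0)) (\<lambda>k. w (Suc k)))"

text \<open>The recursions of \<open>level\<close> and \<open>epoch\<close> peel off the last gain,
  whereas conditioning removes the first. This lemma and \<open>epoch_Suc_shift\<close> express that
  after the first gain the path is again a path of the same kind, driven by the shifted
  sequences.\<close>

lemma level_Suc_shift:
  "level a c B C x (Suc n) = level a c (\<lambda>k. B (Suc k)) (\<lambda>k. C (Suc k)) (level a c B C x 1) n"
  by (induction n) auto

lemma epoch_Suc_shift:
  "epoch a c B C x (Suc n)
     = c * x + B 0 + epoch a c (\<lambda>k. B (Suc k)) (\<lambda>k. C (Suc k)) (level a c B C x 1) n"
proof (induction n)
  case (Suc n)
  then show ?case
    using level_Suc_shift[of a c B C x n] by (simp del: level.simps(2) add: epoch.simps)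
qed simp

lemma level_1_next_level: "path_level a c x w (Suc 0) = next_level a c x (w 0)"
  by (simp add: next_level_def algebra_simps)

lemma stopped_discount_no_ruin:
  assumes "\<And>k. k < n \<Longrightarrow> fst (w k) < (1 - c) * path_level a c x w k"
  shows "stopped_discount a c s n x w = 0"
  using assms
proof (induction n arbitrary: x w)
  case (Suc n)
  have "fst (w (Suc k)) < (1 - c) * path_level a c (next_level a c x (w 0)) (\<lambda>k. w (Suc k)) k"
    if "k < n" for k
    using Suc.prems[of "Suc k"] that
      level_Suc_shift[of a c "\<lambda>n. fst (w n)" "\<lambda>n. snd (w n)" x k]
    by (simp add: level_1_next_level del: level.simps(2))
  then show ?case using Suc.IH Suc.prems[of 0] by simp
qed simp

lemma stopped_discount_ruin:
  assumes "\<And>k. k < m \<Longrightarrow> fst (w k) < (1 - c) * path_level a c x w k"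
    and "(1 - c) * path_level a c x w m \<le> fst (w m)" and "m < n"
  shows "stopped_discount a c s n x w
           = exp (- s * of_real (path_epoch a c x w m + path_level a c x w m))"
  using assms
proof (induction n arbitrary: x w m)
  case (Suc n)
  show ?case
  proof (cases m)
    case (Suc k)
    note sh = level_Suc_shift[of a c "\<lambda>n. fst (w n)" "\<lambda>n. snd (w n)" x]
      epoch_Suc_shift[of a c "\<lambda>n. fst (w n)" "\<lambda>n. snd (w n)" x]
    let ?x = "next_level a c x (w 0)" and ?w = "\<lambda>k. w (Suc k)"
    have 1: "stopped_discount a c s n ?x ?w
           = exp (- s * of_real (path_epoch a c ?x ?w k + path_level a c ?x ?w k))"
    proof (rule Suc.IH)
      show "k < n" using Suc.prems(3) Suc by simp
      show "(1 - c) * path_level a c ?x ?w k \<le> fst (?w k)"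
        using Suc.prems(2) sh(1)[of k] Suc by (simp add: level_1_next_level del: level.simps(2))
      show "fst (?w j) < (1 - c) * path_level a c ?x ?w j" if "j < k" for j
        using Suc.prems(1)[of "Suc j"] sh(1)[of j] Suc that
        by (simp add: level_1_next_level del: level.simps(2))
    qed
    have 2: "\<not> (1 - c) * x \<le> fst (w 0)" using Suc.prems(1)[of 0] Suc by simp
    have 3: "path_epoch a c x w m + path_level a c x w m
        = (c * x + fst (w 0)) + (path_epoch a c ?x ?w k + path_level a c ?x ?w k)"
      using sh(1)[of k] sh(2)[of k] Suc
      by (simp add: level_1_next_level del: level.simps(2) epoch.simps(2))
    show ?thesis using 1 2 unfolding 3
      by (simp add: exp_add[symmetric] algebra_simps del: level.simps epoch.simps)
  qed (use Suc.prems in simp)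
qed simp

text \<open>
  The last two conditions exclude the null events where a gain arrives at the very moment of ruin,
  or where infinitely many gains accumulate in finite time.
\<close>

definition regular_path :: "real \<Rightarrow> real \<Rightarrow> real \<Rightarrow> (nat \<Rightarrow> real \<times> real) \<Rightarrow> bool" where
  "regular_path a c x w \<longleftrightarrow>
     (\<forall>n. 0 < fst (w n) \<and> 0 < snd (w n)) \<and> (\<forall>n. fst (w n) \<noteq> (1 - c) * path_level a c x w n)
     \<and> (\<exists>d>0. \<forall>m. \<exists>n\<ge>m. d < fst (w n))"

lemma level_pos:
  assumes "0 \<le> a" "0 < x" "\<And>k. k < n \<Longrightarrow> fst (w k) < (1 - c) * path_level a c x w k"
    and "\<And>k. 0 < snd (w k)"
  shows "0 < path_level a c x w n"
  using assms(3)
proof (induction n)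
  case (Suc n)
  have "0 < (1 + a) * (path_level a c x w n - (c * path_level a c x w n + fst (w n)))"
    using Suc.prems[of n] assms(1) by (intro mult_pos_pos) (auto simp: algebra_simps)
  then show ?case using assms(4)[of n] by simp
qed (use assms in simp)

lemma surplus_eq:
  assumes "t < epoch a c B C x (Suc n)" "\<And>k. k \<le> n \<Longrightarrow> epoch a c B C x k \<le> t"
  shows "surplus a c B C x t = level a c B C x n - (t - epoch a c B C x n)"
proof -
  have "(LEAST n. t < epoch a c B C x (Suc n)) = n"
  proof (rule Least_equality)
    fix m assume m: "t < epoch a c B C x (Suc m)"
    show "n \<le> m"
    proof (rule ccontr)
      assume "\<not> n \<le> m"
      then show False using assms(2)[of "Suc m"] m by (simp del: epoch.simps)
    qed
  qed fact
  then show ?thesis unfolding surplus_def by simp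
qed

text \<open>In a gap \<open>m < n\<close> the surplus falls from \<open>level m\<close> during
  \<open>c * level m + B m\<close>, which is shorter than \<open>level m\<close> by
  \<open>noruin\<close>. In gap \<open>n\<close> the last condition on \<open>t\<close> keeps it
  positive.\<close>

lemma surplus_pos_before_ruin:
  assumes "0 \<le> a" "0 < c" "0 < x" "\<And>k. 0 < fst (w k)" "\<And>k. 0 < snd (w k)"
    and noruin: "\<And>k. k < n \<Longrightarrow> fst (w k) < (1 - c) * path_level a c x w k"
    and t: "0 \<le> t" "t < path_epoch a c x w (Suc n)" "t < path_epoch a c x w n + path_level a c x w n"
  shows "0 < surplus a c (\<lambda>n. fst (w n)) (\<lambda>n. snd (w n)) x t"
proof -
  let ?e = "path_epoch a c x w" and ?l = "path_level a c x w"
  define m where "m = (LEAST m. t < ?e (Suc m))"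
  have m1: "t < ?e (Suc m)" unfolding m_def using t(2) by (rule LeastI)
  have mn: "m \<le> n" unfolding m_def using t(2) by (rule Least_le)
  have "surplus a c (\<lambda>n. fst (w n)) (\<lambda>n. snd (w n)) x t = ?l m - (t - ?e m)"
    unfolding surplus_def m_def[symmetric] Let_def by simp
  moreover have "t < ?e m + ?l m"
  proof (cases "m = n")
    case False
    with noruin[of m] mn m1 show ?thesis by (simp add: algebra_simps)
  qed (use t in simp)
  ultimately show ?thesis by simp
qed

lemma epoch_le_epoch:
  assumes "0 \<le> a" "0 < c" "0 < x" "\<And>k. 0 < fst (w k)" "\<And>k. 0 < snd (w k)"
    and noruin: "\<And>k. k < n \<Longrightarrow> fst (w k) < (1 - c) * path_level a c x w k" and "j \<le> k" "k \<le> Suc n"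
  shows "path_epoch a c x w j \<le> path_epoch a c x w k"
  using assms(7,8)
proof (induction k rule: dec_induct)
  case (step k)
  have "0 < path_level a c x w k" using step noruin by (intro level_pos assms) auto
  then show ?case using step assms(2) assms(4)[of k] by (simp add: add_increasing2)
qed simp

lemma ruin_time_eq_ruin:
  assumes ac: "0 \<le> a" "0 < c" "0 < x" and reg: "regular_path a c x w"
    and noruin: "\<And>k. k < n \<Longrightarrow> fst (w k) < (1 - c) * path_level a c x w k"
    and ruin: "(1 - c) * path_level a c x w n \<le> fst (w n)"
  shows "path_ruin_time a c x w = ereal (path_epoch a c x w n + path_level a c x w n)"
proof -
  let ?e = "path_epoch a c x w" and ?l = "path_level a c x w"
  let ?B = "\<lambda>n. fst (w n)" and ?C = "\<lambda>n. snd (w n)"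
  have pos: "0 < fst (w k)" "0 < snd (w k)" for k using reg by (auto simp: regular_path_def)
  have lpos: "0 < ?l n" using noruin pos by (intro level_pos ac) auto
  \<comment> \<open>A tie has to be excluded: at the epoch of the gain itself \<open>surplus\<close>
    already uses the level after the jump, so the zero would be missed.\<close>
  have "fst (w n) \<noteq> (1 - c) * ?l n" using reg unfolding regular_path_def by blast
  then have ruin': "(1 - c) * ?l n < fst (w n)" using ruin by linarith
  let ?t = "?e n + ?l n"
  have le: "?e k \<le> ?e n" if "k \<le> n" for k
    using that noruin pos by (intro epoch_le_epoch[where n=n] ac) auto
  have lt: "?t < ?e (Suc n)" using ruin' by (simp add: algebra_simps)
  have z: "surplus a c ?B ?C x ?t = 0"
    by (subst surplus_eq[where n=n]) (use lt lpos le in \<open>fastforce simp del: epoch.simps(2)\<close>)+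
  have t0: "0 \<le> ?t" using le[of 0] lpos by simp
  show ?thesis unfolding ruin_time_def
  proof (rule Inf_eqI)
    fix i assume "i \<in> {ereal t |t. 0 \<le> t \<and> surplus a c ?B ?C x t = 0}"
    then obtain t where t: "i = ereal t" "0 \<le> t" "surplus a c ?B ?C x t = 0" by auto
    have "\<not> t < ?t"
    proof
      assume "t < ?t"
      then have "0 < surplus a c ?B ?C x t"
        using surplus_pos_before_ruin[where n=n, OF ac pos noruin t(2)] lt by linarith
      then show False using t by simp
    qed
    then show "ereal ?t \<le> i" using t by simp
  qed (use z t0 in auto)
qed

lemma ruin_time_eq_infinity:
  assumes ac: "0 \<le> a" "0 < c" "0 < x" and reg: "regular_path a c x w"
    and noruin: "\<And>k. fst (w k) < (1 - c) * path_level a c x w k"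
  shows "path_ruin_time a c x w = \<infinity>"
proof -
  let ?e = "path_epoch a c x w" and ?l = "path_level a c x w"
  let ?B = "\<lambda>n. fst (w n)" and ?C = "\<lambda>n. snd (w n)"
  have pos: "0 < fst (w k)" "0 < snd (w k)" for k using reg by (auto simp: regular_path_def)
  have lpos: "0 < ?l n" for n using noruin pos by (intro level_pos ac) auto
  have mono: "?e j \<le> ?e k" if "j \<le> k" for j k
    using that noruin pos by (intro epoch_le_epoch[where n=k] ac) auto
  obtain d where d: "0 < d" "\<And>m. \<exists>n\<ge>m. d < fst (w n)"
    using reg unfolding regular_path_def by blast
  \<comment> \<open>Each gap longer than \<open>d\<close> moves the epoch on by at least
    \<open>d\<close>, and such gaps recur, so every time lies before some epoch.\<close>
  have unb: "\<exists>n. real N * d \<le> ?e n" for N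
  proof (induction N)
    case 0 show ?case by (rule exI[of _ 0]) simp
  next
    case (Suc N)
    then obtain n where n: "real N * d \<le> ?e n" by blast
    obtain m where m: "m \<ge> n" "d < fst (w m)" using d(2) by blast
    have "0 < c * ?l m" using lpos ac by simp
    then have "real (Suc N) * d \<le> ?e (Suc m)" using n m mono[of n m] by (simp add: algebra_simps)
    then show ?case by blast
  qed
  have "surplus a c ?B ?C x t > 0" if "0 \<le> t" for t
  proof -
    obtain N where "t < real N * d" using ex_less_of_nat_mult[OF d(1)] by blast
    then obtain n where n: "t < ?e n" using unb[of N] by (meson less_le_trans)
    then have "t < ?e (Suc n)" "t < ?e n + ?l n" using mono[of n "Suc n"] lpos[of n] by auto
    then show ?thesis using surplus_pos_before_ruin[OF ac pos noruin that] by blast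
  qed
  then have E: "{ereal t |t. 0 \<le> t \<and> surplus a c ?B ?C x t = 0} = {}" by force
  show ?thesis unfolding ruin_time_def E by (simp add: top_ereal_def)
qed

lemma stopped_discount_tendsto:
  assumes ac: "0 \<le> a" "0 < c" "0 < x" and reg: "regular_path a c x w"
  shows "(\<lambda>n. stopped_discount a c s n x w) \<longlonglongrightarrow> discount s (path_ruin_time a c x w)"
proof (cases "\<exists>n. (1 - c) * path_level a c x w n \<le> fst (w n)")
  case True
  define m where "m = (LEAST n. (1 - c) * path_level a c x w n \<le> fst (w n))"
  have m: "(1 - c) * path_level a c x w m \<le> fst (w m)" unfolding m_def using True by (rule LeastI_ex)
  have m': "fst (w k) < (1 - c) * path_level a c x w k" if "k < m" for k
    using not_less_Least[OF that[unfolded m_def]] by simp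
  have "path_ruin_time a c x w = ereal (path_epoch a c x w m + path_level a c x w m)"
    by (rule ruin_time_eq_ruin[OF ac reg m' m])
  then have "discount s (path_ruin_time a c x w)
      = exp (- s * of_real (path_epoch a c x w m + path_level a c x w m))"
    by (simp add: discount_def)
  then have "\<forall>n\<ge>Suc m. stopped_discount a c s n x w = discount s (path_ruin_time a c x w)"
    using stopped_discount_ruin[OF m' m] by auto
  then show ?thesis by (metis (mono_tags, lifting) eventually_sequentially tendsto_eventually)
next
  case False
  then have no: "fst (w k) < (1 - c) * path_level a c x w k" for k by (simp add: not_le)
  then show ?thesis
    using stopped_discount_no_ruin[OF no] ruin_time_eq_infinity[OF ac reg no] by (simp add: discount_def)
qed

text \<open>A gain never lowers the surplus, so elapsed time plus new level is at least
  \<open>x\<close>. This is the induction step behind "ruin takes at least time \<open>x\<close>",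
  the source of the bound \<open>exp (- Re s * x)\<close>.\<close>

lemma next_level_lower:
  assumes "0 \<le> a" "fst z < (1 - c) * x" "0 \<le> snd z"
  shows "x \<le> c * x + fst z + next_level a c x z"
proof -
  have "0 \<le> a * ((1 - c) * x - fst z)" using assms by (intro mult_nonneg_nonneg) auto
  then show ?thesis using assms(3) unfolding next_level_def by (simp add: algebra_simps)
qed

lemma next_level_pos:
  assumes "0 \<le> a" "fst z < (1 - c) * x" "0 \<le> snd z"
  shows "0 < next_level a c x z"
proof -
  have "0 < (1 + a) * ((1 - c) * x - fst z)" using assms by (intro mult_pos_pos) auto
  then show ?thesis using assms(3) unfolding next_level_def by simp
qed

lemma norm_stopped_discount_le:
  assumes "0 \<le> a" "0 \<le> Re s" "0 < x" "\<And>n. 0 \<le> snd (w n)"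
  shows "norm (stopped_discount a c s n x w) \<le> exp (- Re s * x)"
  using assms(3,4)
proof (induction n arbitrary: x w)
  case (Suc n)
  show ?case
  proof (cases "(1 - c) * x \<le> fst (w 0)")
    case False
    let ?y = "next_level a c x (w 0)"
    have y: "0 < ?y" using False Suc.prems(2) assms(1) by (intro next_level_pos) auto
    have "norm (stopped_discount a c s (Suc n) x w)
        = exp (- Re s * (c * x + fst (w 0))) * norm (stopped_discount a c s n ?y (\<lambda>k. w (Suc k)))"
      using False by (simp add: norm_mult)
    also have "\<dots> \<le> exp (- Re s * (c * x + fst (w 0))) * exp (- Re s * ?y)"
      using Suc.IH[OF y] Suc.prems(2) by simp
    also have "\<dots> = exp (- Re s * (c * x + fst (w 0) + ?y))"
      by (simp add: exp_add[symmetric] algebra_simps)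
    also have "\<dots> \<le> exp (- Re s * x)"
      using next_level_lower[of a "w 0" c x] False Suc.prems(2) assms(1,2)
      by (simp add: mult_left_mono)
    finally show ?thesis .
  qed simp
qed simp

section \<open>Measurability of levels, epochs and ruin times\<close>

lemma measurable_level[measurable]:
  assumes [measurable]: "\<And>n. B n \<in> borel_measurable N" "\<And>n. C n \<in> borel_measurable N" "X \<in> borel_measurable N"
  shows "(\<lambda>w. level a c (\<lambda>n. B n w) (\<lambda>n. C n w) (X w) n) \<in> borel_measurable N"
  by (induction n) auto

lemma measurable_epoch[measurable]:
  assumes [measurable]: "\<And>n. B n \<in> borel_measurable N" "\<And>n. C n \<in> borel_measurable N" "X \<in> borel_measurable N"
  shows "(\<lambda>w. epoch a c (\<lambda>n. B n w) (\<lambda>n. C n w) (X w) n) \<in> borel_measurable N"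
  by (induction n) auto

lemma measurable_surplus:
  assumes [measurable]: "\<And>n. B n \<in> borel_measurable N" "\<And>n. C n \<in> borel_measurable N"
    "X \<in> borel_measurable N" "t \<in> borel_measurable N"
  shows "(\<lambda>w. surplus a c (\<lambda>n. B n w) (\<lambda>n. C n w) (X w) (t w)) \<in> borel_measurable N"
proof -
  \<comment> \<open>The index of the current gap depends on \<open>w\<close>, but it is measurable
    and takes countably many values, so each value can be treated separately.\<close>
  define k where "k w = (LEAST n. t w < epoch a c (\<lambda>n. B n w) (\<lambda>n. C n w) (X w) (Suc n))" for w
  have [measurable]: "k \<in> measurable N (count_space UNIV)"
    unfolding k_def by measurable
  have "(\<lambda>w. level a c (\<lambda>n. B n w) (\<lambda>n. C n w) (X w) (k w)
      - (t w - epoch a c (\<lambda>n. B n w) (\<lambda>n. C n w) (X w) (k w))) \<in> borel_measurable N"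
    by (rule measurable_compose_countable[where f="\<lambda>n w. level a c (\<lambda>n. B n w) (\<lambda>n. C n w) (X w) n
      - (t w - epoch a c (\<lambda>n. B n w) (\<lambda>n. C n w) (X w) n)" and g=k]) auto
  then show ?thesis unfolding surplus_def k_def Let_def .
qed

text \<open>
  Every zero of the surplus is of the form \<open>epoch n + level n\<close>, so the infimum in the ruin time
  runs over a countable family. This gives measurability for all paths, irregular ones included.
\<close>

lemma measurable_ruin_time:
  assumes [measurable]: "\<And>n. B n \<in> borel_measurable N" "\<And>n. C n \<in> borel_measurable N" "X \<in> borel_measurable N"
  shows "(\<lambda>w. ruin_time a c (\<lambda>n. B n w) (\<lambda>n. C n w) (X w)) \<in> borel_measurable N"
proof (rule borel_measurableI_less)
  fix y :: ereal
  let ?t = "\<lambda>n w. epoch a c (\<lambda>n. B n w) (\<lambda>n. C n w) (X w) n + level a c (\<lambda>n. B n w) (\<lambda>n. C n w) (X w) n"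
  let ?s = "\<lambda>w. surplus a c (\<lambda>n. B n w) (\<lambda>n. C n w) (X w)"
  have [measurable]: "(\<lambda>w. ?s w (?t n w)) \<in> borel_measurable N" for n
    by (intro measurable_surplus) auto
  have "ruin_time a c (\<lambda>n. B n w) (\<lambda>n. C n w) (X w) < y
      \<longleftrightarrow> (\<exists>n. 0 \<le> ?t n w \<and> ?s w (?t n w) = 0 \<and> ereal (?t n w) < y)" for w
  proof -
    have "\<exists>n. t = ?t n w" if "?s w t = 0" for t
      using that unfolding surplus_def Let_def by (metis add.commute diff_eq_diff_eq diff_zero eq_diff_eq')
    then show ?thesis unfolding ruin_time_def Inf_less_iff by blast
  qed
  then show "{w \<in> space N. ruin_time a c (\<lambda>n. B n w) (\<lambda>n. C n w) (X w) < y} \<in> sets N"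
    by simp
qed

lemma measurable_discount[measurable]: "discount s \<in> borel_measurable borel"
  unfolding discount_def by measurable

section \<open>The law of the gains and the renewal equation\<close>

lemma measurable_fst_snd_borel[measurable]:
  "(fst :: real \<times> real \<Rightarrow> real) \<in> borel_measurable borel"
  "(snd :: real \<times> real \<Rightarrow> real) \<in> borel_measurable borel"
  by (intro borel_measurable_continuous_onI continuous_intros)+

locale fgm_dual_risk = prob_space M for M :: "'w measure" +
  fixes B C :: "nat \<Rightarrow> 'w \<Rightarrow> real"
    and lam mu a c theta :: real
    and s :: complex
  assumes indep_BC: "indep_vars (\<lambda>_. borel) (\<lambda>n w. (B n w, C n w)) UNIV"
    and distributed_BC: "distributed M (lborel \<Otimes>\<^sub>M lborel) (\<lambda>w. (B n w, C n w))
               (\<lambda>z. ennreal (fgm_density lam mu theta z))"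
    and lam_pos: "0 < lam" and mu_pos: "0 < mu" and a_nonneg: "0 \<le> a"
    and c_pos: "0 < c" and c_less_1: "c < 1"
    and theta_ge: "- 1 \<le> theta" and theta_le: "theta \<le> 1"
    and Re_s_nonneg: "0 \<le> Re s"
begin

section \<open>The law of one gain and the product law of the gain sequence\<close>

definition gain_law :: "(real \<times> real) measure" where
  "gain_law = density lborel (\<lambda>z. ennreal (fgm_density lam mu theta z))"

abbreviation path_law :: "(nat \<Rightarrow> real \<times> real) measure" where
  "path_law \<equiv> \<Pi>\<^sub>M n\<in>UNIV. gain_law"

lemma sets_gain_law[simp, measurable_cong]: "sets gain_law = sets borel"
  by (simp add: gain_law_def)

lemma space_gain_law[simp]: "space gain_law = UNIV"
  by (simp add: gain_law_def)

lemma distr_BC: "distr M borel (\<lambda>w. (B n w, C n w)) = gain_law"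
proof -
  have "distr M (lborel \<Otimes>\<^sub>M lborel) (\<lambda>w. (B n w, C n w)) = gain_law"
    using distributed_distr_eq_density[OF distributed_BC[of n]] by (simp add: gain_law_def lborel_prod)
  moreover have "distr M (lborel \<Otimes>\<^sub>M lborel) (\<lambda>w. (B n w, C n w)) = distr M borel (\<lambda>w. (B n w, C n w))"
    by (rule distr_cong) (simp_all only: lborel_prod sets_lborel)
  ultimately show ?thesis by simp
qed

lemma measurable_BC[measurable]: "(\<lambda>w. (B n w, C n w)) \<in> borel_measurable M"
  using distributed_measurable[OF distributed_BC[of n]] by (simp add: lborel_prod)

lemma prob_space_gain_law: "prob_space gain_law"
  using prob_space_distr[OF measurable_BC[of 0]] by (simp add: distr_BC)

sublocale gains: sequence_space gain_law
  using prob_space_gain_law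
  by (auto simp: sequence_space_def product_prob_space_def product_prob_space_axioms_def
      product_sigma_finite_def prob_space_imp_sigma_finite)

lemma measurable_BC_path[measurable]: "(\<lambda>w n. (B n w, C n w)) \<in> measurable M path_law"
  by (intro measurable_PiM_single') (auto simp: space_PiM)

text \<open>Independence of the pairs identifies the law of the whole sequence with the infinite
  product of \<open>gain_law\<close>. It transfers all expectations from \<open>M\<close> to the
  path space.\<close>

lemma distr_BC_path: "distr M path_law (\<lambda>w n. (B n w, C n w)) = path_law"
proof -
  have "distr M (\<Pi>\<^sub>M i\<in>UNIV. borel) (\<lambda>w. \<lambda>i\<in>UNIV. (B i w, C i w))
      = (\<Pi>\<^sub>M i\<in>UNIV. distr M borel (\<lambda>w. (B i w, C i w)))"
    using indep_BC by (subst indep_vars_iff_distr_eq_PiM[symmetric]) auto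
  then have "distr M (\<Pi>\<^sub>M i\<in>UNIV. borel) (\<lambda>w n. (B n w, C n w)) = path_law"
    by (simp add: distr_BC restrict_def)
  moreover have "distr M (\<Pi>\<^sub>M i\<in>UNIV. borel) (\<lambda>w n. (B n w, C n w))
      = distr M path_law (\<lambda>w n. (B n w, C n w))"
    by (intro distr_cong sets_PiM_cong) auto
  ultimately show ?thesis by simp
qed

lemma measurable_path_component[measurable]:
  "(\<lambda>w. fst (w n)) \<in> borel_measurable path_law" "(\<lambda>w. snd (w n)) \<in> borel_measurable path_law"
proof -
  have 1: "(\<lambda>w. w n) \<in> measurable path_law gain_law" by (rule measurable_component_singleton) simp
  then have [measurable]: "(\<lambda>w. w n) \<in> borel_measurable path_law"
    by (simp cong: measurable_cong_sets)
  show "(\<lambda>w. fst (w n)) \<in> borel_measurable path_law" "(\<lambda>w. snd (w n)) \<in> borel_measurable path_law"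
    by simp_all
qed

lemma ruin_lst_eq_path_integral:
  "ruin_lst M B C a c s x = (\<integral>w. discount s (path_ruin_time a c x w) \<partial>path_law)"
proof -
  have [measurable]: "(\<lambda>w. path_ruin_time a c x w) \<in> borel_measurable path_law"
    by (intro measurable_ruin_time) auto
  have "(\<integral>w. discount s (path_ruin_time a c x w) \<partial>distr M path_law (\<lambda>w n. (B n w, C n w)))
      = ruin_lst M B C a c s x"
    unfolding ruin_lst_def by (subst integral_distr) auto
  then show ?thesis by (simp add: distr_BC_path)
qed

sublocale gains_pair: pair_prob_space gain_law path_law
  by unfold_locales

section \<open>Splitting off the first gain, and regularity of almost all paths\<close>

lemma measurable_case_nat_path[measurable]:
  "(\<lambda>(z, w). case_nat z w) \<in> measurable (gain_law \<Otimes>\<^sub>M path_law) path_law"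
  by measurable

text \<open>Prepending an independent gain to a path reproduces \<open>path_law\<close>
  (\<open>gains.PiM_iter\<close>), so almost sure properties may be checked after fixing the first
  gain. \<open>integral_path_iter\<close> is the counterpart for expectations, where the bound
  supplies the integrability for Fubini.\<close>

lemma AE_path_iter:
  assumes "Measurable.pred path_law P"
    and "AE z in gain_law. AE w in path_law. P (case_nat z w)"
  shows "AE w in path_law. P w"
proof -
  note [measurable] = assms(1)
  have "AE x in gain_law \<Otimes>\<^sub>M path_law. P (case x of (z, w) \<Rightarrow> case_nat z w)"
  proof (rule gains_pair.AE_pair_measure)
    show "{x \<in> space (gain_law \<Otimes>\<^sub>M path_law). P (case x of (z, w) \<Rightarrow> case_nat z w)}
        \<in> sets (gain_law \<Otimes>\<^sub>M path_law)"
      by measurable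
  qed (use assms in simp)
  then have "AE w in distr (gain_law \<Otimes>\<^sub>M path_law) path_law (\<lambda>(z, w). case_nat z w). P w"
    by (subst AE_distr_iff) auto
  then show ?thesis unfolding gains.PiM_iter .
qed

lemma integral_path_iter:
  fixes f :: "_ \<Rightarrow> 'b::{banach, second_countable_topology}"
  assumes [measurable]: "f \<in> borel_measurable path_law"
    and bnd: "AE w in path_law. norm (f w) \<le> K"
  shows "(\<integral>w. f w \<partial>path_law) = (\<integral>z. (\<integral>w. f (case_nat z w) \<partial>path_law) \<partial>gain_law)"
proof -
  let ?N = "gain_law \<Otimes>\<^sub>M path_law"
  have "integrable path_law f"
    by (rule gains.P.integrable_const_bound[OF bnd]) simp
  then have "integrable (distr ?N path_law (\<lambda>(z, w). case_nat z w)) f"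
    by (simp add: gains.PiM_iter)
  then have int: "integrable ?N (\<lambda>x. f (case x of (z, w) \<Rightarrow> case_nat z w))"
    by (subst (asm) integrable_distr_eq) auto
  have "(\<integral>w. f w \<partial>path_law) = (\<integral>w. f w \<partial>distr ?N path_law (\<lambda>(z, w). case_nat z w))"
    by (simp add: gains.PiM_iter)
  also have "\<dots> = (\<integral>x. f (case x of (z, w) \<Rightarrow> case_nat z w) \<partial>?N)"
    by (subst integral_distr) auto
  also have "\<dots> = (\<integral>z. (\<integral>w. f (case_nat z w) \<partial>path_law) \<partial>gain_law)"
    using gains_pair.integral_fst'[OF int] by simp
  finally show ?thesis .
qed

lemma fgm_density_measurable[measurable]: "fgm_density lam mu theta \<in> borel_measurable borel"
  unfolding fgm_density_def case_prod_beta by measurable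

lemma AE_gain_law_iff: "(AE z in gain_law. P z) \<longleftrightarrow> (AE z in lborel. 0 < fgm_density lam mu theta z \<longrightarrow> P z)"
  unfolding gain_law_def by (subst AE_density) auto

lemma AE_gain_ne: "AE z in gain_law. fst z \<noteq> u \<and> snd z \<noteq> u"
proof -
  have 1: "AE z in (lborel \<Otimes>\<^sub>M lborel :: (real \<times> real) measure). fst z \<noteq> u \<and> snd z \<noteq> u"
  proof (rule lborel_pair.AE_pair_measure)
    show "AE x in lborel. AE y in lborel. fst (x, y) \<noteq> u \<and> snd (x, y) \<noteq> u"
      using AE_lborel_singleton[of u] by eventually_elim (use AE_lborel_singleton[of u] in simp)
  qed measurable
  show ?thesis unfolding AE_gain_law_iff using 1 unfolding lborel_prod
    by (rule eventually_mono) blast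
qed

lemma AE_gain_pos: "AE z in gain_law. 0 < fst z \<and> 0 < snd z"
proof -
  have "AE z in gain_law. 0 \<le> fst z \<and> 0 \<le> snd z"
    unfolding AE_gain_law_iff by (intro AE_I2) (auto simp: fgm_density_def split: prod.splits if_splits)
  with AE_gain_ne[of 0] show ?thesis by eventually_elim auto
qed

lemma AE_path_of_AE_gain:
  assumes [measurable]: "Measurable.pred borel P" and "AE z in gain_law. P z"
  shows "AE w in path_law. P (w n)"
  using gains.AE_component[of n P] assms by simp

text \<open>The induction keeps the initial level free. For \<open>n = 0\<close> the level is the
  constant \<open>x\<close> and the gap has no atoms; a later index is lowered by fixing the first
  gain \<open>z\<close> and restarting from \<open>next_level a c x z\<close>.\<close>

lemma AE_path_ne_level:
  "AE w in path_law. fst (w n) \<noteq> (1 - c) * path_level a c x w n"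
proof (induction n arbitrary: x)
  case 0
  have "AE z in gain_law. fst z \<noteq> (1 - c) * x"
    using AE_gain_ne[of "(1 - c) * x"] by eventually_elim simp
  then show ?case
    using AE_path_of_AE_gain[where P="\<lambda>z. fst z \<noteq> (1 - c) * x" and n=0] by simp
next
  case (Suc n)
  show ?case
  proof (rule AE_path_iter, goal_cases)
    case 2
    have "fst (case_nat z w (Suc n)) \<noteq> (1 - c) * path_level a c x (case_nat z w) (Suc n)
        \<longleftrightarrow> fst (w n) \<noteq> (1 - c) * path_level a c (next_level a c x z) w n" for z w
      by (subst level_Suc_shift) (simp add: next_level_def algebra_simps)
    then have "AE w in path_law. fst (case_nat z w (Suc n)) \<noteq> (1 - c) * path_level a c x (case_nat z w) (Suc n)" for z
      using Suc.IH[of "next_level a c x z"] by (simp del: level.simps)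
    then show ?case by (rule AE_I2)
  next
    case 1
    have "(\<lambda>w. path_level a c x w (Suc n)) \<in> borel_measurable path_law"
      by (intro measurable_level) auto
    then show ?case unfolding pred_def by (intro borel_measurable_neq) (auto simp del: level.simps)
  qed
qed

text \<open>Since gaps are almost surely positive, some \<open>d > 0\<close> is exceeded with
  positive probability. Splitting off the first gap shows that the probability that all gaps are at
  most \<open>d\<close> equals itself times \<open>measure gain_law ?A\<close>, a number other than
  1; hence it is 0.\<close>

lemma AE_path_gain_gt:
  "\<exists>d>0. AE w in path_law. \<forall>m. \<exists>n\<ge>m. d < fst (w n)"
proof -
  have "\<exists>k::nat. \<not> (AE z in gain_law. fst z \<le> 1 / real (Suc k))"
  proof (rule ccontr)
    assume "\<not> ?thesis"
    then have "AE z in gain_law. \<forall>k::nat. fst z \<le> 1 / real (Suc k)" by (auto simp: AE_all_countable)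
    with AE_gain_pos have "AE z in gain_law. False"
    proof eventually_elim
      case (elim z)
      then obtain k where "inverse (real (Suc k)) < fst z" using reals_Archimedean by blast
      then show False using elim by (auto simp: inverse_eq_divide not_less[symmetric])
    qed
    then show False by simp
  qed
  then obtain k :: nat where k: "\<not> (AE z in gain_law. fst z \<le> 1 / real (Suc k))" by blast
  define d where "d = 1 / real (Suc k)"
  have d: "0 < d" by (simp add: d_def)
  let ?A = "{z. fst z \<le> d}" and ?E = "{w \<in> space path_law. \<forall>n. fst (w n) \<le> d}"
  have A[measurable]: "?A \<in> sets gain_law" by measurable
  have E[measurable]: "?E \<in> sets path_law" by measurable
  have p: "measure gain_law ?A \<noteq> 1"
    using k prob_space.prob_eq_1[OF prob_space_gain_law A] by (simp add: d_def)
  have ind: "(indicator ?E (case_nat z w) :: real) = indicator ?A z * indicator ?E w"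
    if "w \<in> space path_law" for z w
  proof -
    have "case_nat z w \<in> space path_law" by (auto simp: space_PiM)
    moreover have "(\<forall>n. fst (case_nat z w n) \<le> d) \<longleftrightarrow> fst z \<le> d \<and> (\<forall>n. fst (w n) \<le> d)"
      by (auto split: nat.splits)
    ultimately show ?thesis using that by (auto simp: indicator_def)
  qed
  have "gains.P.prob ?E = (\<integral>w. indicator ?E w \<partial>path_law)"
    by simp
  also have "\<dots> = (\<integral>z. (\<integral>w. indicator ?E (case_nat z w) \<partial>path_law) \<partial>gain_law)"
    by (rule integral_path_iter[where K=1]) (auto simp: indicator_def)
  also have "\<dots> = (\<integral>z. (\<integral>w. indicator ?A z * indicator ?E w \<partial>path_law) \<partial>gain_law)"
    using ind by (intro Bochner_Integration.integral_cong refl) auto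
  also have "\<dots> = measure gain_law ?A * gains.P.prob ?E"
    by simp
  finally have "gains.P.prob ?E = 0" using p by simp
  then have "AE w in path_law. \<not> (\<forall>n. fst (w n) \<le> d)"
    by (subst (asm) gains.P.prob_eq_0[OF E]) (auto elim!: eventually_mono simp: space_PiM)
  then have base: "AE w in path_law. \<exists>n\<ge>0. d < fst (w n)"
    by eventually_elim (auto simp: not_le)
  \<comment> \<open>The shifted sequence has the same law, so a gap above \<open>d\<close> also
    occurs beyond every index.\<close>
  have "AE w in path_law. \<exists>n\<ge>m. d < fst (w n)" for m
  proof (induction m)
    case (Suc m)
    show ?case
    proof (rule AE_path_iter, goal_cases)
      case 2
      have "AE w in path_law. \<exists>n\<ge>Suc m. d < fst (case_nat z w n)" for z
        using Suc by eventually_elim (metis Suc_le_mono nat.case(2))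
      then show ?case by (rule AE_I2)
    qed measurable
  qed (rule base)
  then have "AE w in path_law. \<forall>m. \<exists>n\<ge>m. d < fst (w n)" by (simp add: AE_all_countable)
  with d show ?thesis by blast
qed

lemma AE_regular_path: "AE w in path_law. regular_path a c x w"
proof -
  obtain d where d: "0 < d" "AE w in path_law. \<forall>m. \<exists>n\<ge>m. d < fst (w n)"
    using AE_path_gain_gt by blast
  have "AE w in path_law. 0 < fst (w n) \<and> 0 < snd (w n)" for n
    using AE_gain_pos by (intro AE_path_of_AE_gain[where P="\<lambda>z. 0 < fst z \<and> 0 < snd z"]) auto
  then have "AE w in path_law. \<forall>n. 0 < fst (w n) \<and> 0 < snd (w n)" by (simp add: AE_all_countable)
  moreover have "AE w in path_law. \<forall>n. fst (w n) \<noteq> (1 - c) * path_level a c x w n"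
    by (simp add: AE_all_countable AE_path_ne_level)
  ultimately show ?thesis using d(2)
    by eventually_elim (use d(1) in \<open>auto simp: regular_path_def\<close>)
qed

section \<open>Truncated transforms and the renewal equation\<close>

lemma measurable_stopped_discount[measurable]:
  assumes "X \<in> borel_measurable N" "W \<in> measurable N path_law"
  shows "(\<lambda>v. stopped_discount a c s n (X v) (W v)) \<in> borel_measurable N"
  using assms
proof (induction n arbitrary: X W)
  case (Suc n)
  note [measurable] = Suc.prems
  have comp: "(\<lambda>v. W v k) \<in> measurable N gain_law" for k
    using Suc.prems(2) by measurable
  have [measurable]: "(\<lambda>v. fst (W v k)) \<in> borel_measurable N" "(\<lambda>v. snd (W v k)) \<in> borel_measurable N" for k
    using measurable_compose[OF Suc.prems(2) measurable_path_component(1)[of k]]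
      measurable_compose[OF Suc.prems(2) measurable_path_component(2)[of k]] by auto
  have [measurable]: "(\<lambda>v. stopped_discount a c s n (next_level a c (X v) (W v 0)) (\<lambda>k. W v (Suc k))) \<in> borel_measurable N"
  proof (rule Suc.IH)
    show "(\<lambda>v. next_level a c (X v) (W v 0)) \<in> borel_measurable N"
      unfolding next_level_def by measurable
    show "(\<lambda>v k. W v (Suc k)) \<in> measurable N path_law"
      by (intro measurable_PiM_single' comp) (auto simp: space_PiM)
  qed
  show ?case by simp
qed simp

text \<open>A bounded number of gains gives measurability in the initial level and permits induction
  on that number. \<open>lst\<close> inherits measurability, bounds and the renewal equation as the
  pointwise limit.\<close>

definition truncated_lst :: "nat \<Rightarrow> real \<Rightarrow> complex" where
  "truncated_lst n x = (\<integral>w. stopped_discount a c s n x w \<partial>path_law)"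

definition gain_step :: "(real \<Rightarrow> complex) \<Rightarrow> real \<Rightarrow> real \<times> real \<Rightarrow> complex" where
  "gain_step h x z = (if (1 - c) * x \<le> fst z then exp (- s * of_real x)
     else exp (- s * of_real (c * x + fst z)) * h (next_level a c x z))"

lemma AE_norm_stopped_discount_le:
  "0 < x \<Longrightarrow> AE w in path_law. norm (stopped_discount a c s n x w) \<le> exp (- Re s * x)"
  using AE_regular_path[of x]
  by eventually_elim
    (intro norm_stopped_discount_le a_nonneg Re_s_nonneg, auto simp: regular_path_def intro: less_imp_le)

lemma measurable_truncated_lst[measurable]: "truncated_lst n \<in> borel_measurable borel"
  unfolding truncated_lst_def
  by (rule gains.P.borel_measurable_lebesgue_integral) measurable

lemma truncated_lst_0[simp]: "truncated_lst 0 x = 0"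
  by (simp add: truncated_lst_def)

lemma truncated_lst_Suc:
  assumes "0 < x"
  shows "truncated_lst (Suc n) x = (\<integral>z. gain_step (truncated_lst n) x z \<partial>gain_law)"
proof -
  have "truncated_lst (Suc n) x
      = (\<integral>z. (\<integral>w. stopped_discount a c s (Suc n) x (case_nat z w) \<partial>path_law) \<partial>gain_law)"
    unfolding truncated_lst_def
    by (rule integral_path_iter[OF _ AE_norm_stopped_discount_le[OF assms]]) measurable
  also have "\<dots> = (\<integral>z. gain_step (truncated_lst n) x z \<partial>gain_law)"
    by (intro Bochner_Integration.integral_cong refl)
       (auto simp: gain_step_def truncated_lst_def gains.P.prob_space)
  finally show ?thesis .
qed

lemma norm_truncated_lst_le:
  assumes "0 < x" shows "norm (truncated_lst n x) \<le> exp (- Re s * x)"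
proof -
  have "norm (truncated_lst n x) \<le> (\<integral>w. norm (stopped_discount a c s n x w) \<partial>path_law)"
    unfolding truncated_lst_def by (rule integral_norm_bound)
  also have "\<dots> \<le> (\<integral>w. exp (- Re s * x) \<partial>path_law)"
    using AE_norm_stopped_discount_le[OF assms, of n]
    by (intro integral_mono_AE gains.P.integrable_const_bound[where B="exp (- Re s * x)"]) auto
  finally show ?thesis by (simp add: gains.P.prob_space)
qed

abbreviation "lst \<equiv> ruin_lst M B C a c s"

lemma truncated_lst_tendsto:
  assumes "0 < x" shows "(\<lambda>n. truncated_lst n x) \<longlonglongrightarrow> lst x"
  unfolding truncated_lst_def ruin_lst_eq_path_integral
proof (rule integral_dominated_convergence)
  show "(\<lambda>w. discount s (path_ruin_time a c x w)) \<in> borel_measurable path_law"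
    by (intro measurable_compose[OF measurable_ruin_time measurable_discount]) auto
  show "AE w in path_law. norm (stopped_discount a c s n x w) \<le> exp (- Re s * x)" for n
    by (rule AE_norm_stopped_discount_le[OF assms])
  show "AE w in path_law. (\<lambda>n. stopped_discount a c s n x w) \<longlonglongrightarrow> discount s (path_ruin_time a c x w)"
    using AE_regular_path[of x]
    by eventually_elim (rule stopped_discount_tendsto[OF a_nonneg c_pos assms])
qed simp_all

lemma norm_lst_le:
  assumes "0 < x" shows "norm (lst x) \<le> exp (- Re s * x)"
  using norm_truncated_lst_le[OF assms]
  by (intro LIMSEQ_le_const2[OF tendsto_norm[OF truncated_lst_tendsto[OF assms]]]) blast

text \<open>The extension by 0 lets Laplace transforms and convolutions run over the whole line;
  positive levels are also where \<open>lst\<close> is known to be the limit of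
  \<open>truncated_lst\<close>.\<close>

definition pos_lst :: "real \<Rightarrow> complex" where
  "pos_lst x = (if 0 < x then lst x else 0)"

lemma measurable_pos_lst[measurable]: "pos_lst \<in> borel_measurable borel"
proof (rule borel_measurable_LIMSEQ_metric)
  show "(\<lambda>n. if 0 < x then truncated_lst n x else 0) \<longlonglongrightarrow> pos_lst x" for x
    using truncated_lst_tendsto[of x] by (simp add: pos_lst_def)
qed measurable

lemma norm_pos_lst_le: "norm (pos_lst x) \<le> exp (- Re s * x)"
  using norm_lst_le[of x] by (simp add: pos_lst_def)

lemma measurable_next_level[measurable]:
  assumes [measurable]: "X \<in> borel_measurable N" "Z \<in> measurable N borel"
  shows "(\<lambda>v. next_level a c (X v) (Z v)) \<in> borel_measurable N"
  unfolding next_level_def by measurable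

lemma measurable_gain_step[measurable]:
  assumes [measurable]: "h \<in> borel_measurable borel"
  shows "gain_step h x \<in> borel_measurable borel"
  unfolding gain_step_def by measurable

lemma norm_gain_step_le:
  assumes "fst z \<ge> 0" "snd z \<ge> 0" "0 < x" "\<And>y. 0 < y \<Longrightarrow> norm (h y) \<le> 1"
  shows "norm (gain_step h x z) \<le> 1"
proof (cases "(1 - c) * x \<le> fst z")
  case True
  then show ?thesis using assms Re_s_nonneg by (simp add: gain_step_def)
next
  case False
  have "norm (h (next_level a c x z)) \<le> 1"
    using False assms a_nonneg by (intro assms(4) next_level_pos) auto
  moreover have "norm (exp (- s * of_real (c * x + fst z))) \<le> 1"
    using assms Re_s_nonneg c_pos by simp
  ultimately have "norm (exp (- s * of_real (c * x + fst z))) * norm (h (next_level a c x z)) \<le> 1"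
    by (intro mult_le_one) auto
  then show ?thesis using False by (simp add: gain_step_def norm_mult)
qed

text \<open>Both sides are limits of \<open>truncated_lst (Suc n) x\<close>. The integrands converge
  because a gain before ruin leads to a positive level, and they are dominated by 1.\<close>

lemma lst_renewal:
  assumes "0 < x" shows "lst x = (\<integral>z. gain_step pos_lst x z \<partial>gain_law)"
proof (rule LIMSEQ_unique)
  show "(\<lambda>n. truncated_lst (Suc n) x) \<longlonglongrightarrow> lst x"
    using truncated_lst_tendsto[OF assms] by (rule LIMSEQ_Suc)
  show "(\<lambda>n. truncated_lst (Suc n) x) \<longlonglongrightarrow> (\<integral>z. gain_step pos_lst x z \<partial>gain_law)"
    unfolding truncated_lst_Suc[OF assms]
  proof (rule integral_dominated_convergence)
    show "AE z in gain_law. (\<lambda>n. gain_step (truncated_lst n) x z) \<longlonglongrightarrow> gain_step pos_lst x z"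
      using AE_gain_pos
    proof eventually_elim
      case (elim z)
      show ?case
      proof (cases "(1 - c) * x \<le> fst z")
        case False
        then have "0 < next_level a c x z" using elim a_nonneg by (intro next_level_pos) auto
        then show ?thesis using truncated_lst_tendsto[of "next_level a c x z"] False
          by (auto simp: gain_step_def pos_lst_def intro!: tendsto_intros)
      qed (simp add: gain_step_def)
    qed
    have "norm (truncated_lst n y) \<le> 1" if "0 < y" for n y
      by (rule order_trans[OF norm_truncated_lst_le[OF that]]) (use Re_s_nonneg that in simp)
    note bound = this
    show "AE z in gain_law. norm (gain_step (truncated_lst n) x z) \<le> 1" for n
      using AE_gain_pos by eventually_elim (intro norm_gain_step_le assms, auto intro: bound)
  qed simp_all
qed

end

section \<open>Laplace transforms on the half line\<close>

definition laplace :: "(real \<Rightarrow> complex) \<Rightarrow> complex \<Rightarrow> complex" where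
  "laplace f z = (\<integral>x. exp (- z * of_real x) * f x \<partial>lborel)"

text \<open>The rate \<open>r\<close> determines the half plane \<open>0 < Re z + r\<close> on which
  the transform is controlled. It stays a parameter since \<open>pos_lst\<close> is used with two
  rates: \<open>Re s\<close>, and the positive rate found in
  \<open>exp_bounded_pos_lst_expanding\<close>.\<close>

definition exp_bounded :: "(real \<Rightarrow> complex) \<Rightarrow> real \<Rightarrow> real \<Rightarrow> bool" where
  "exp_bounded f K r \<longleftrightarrow> f \<in> borel_measurable borel \<and> (\<forall>x\<le>0. f x = 0)
     \<and> (\<forall>x>0. norm (f x) \<le> K * exp (- r * x))"

section \<open>Integrals of exponentials on the half line\<close>

lemma integrable_exponential_density[simp]: "0 < l \<Longrightarrow> integrable lborel (exponential_density l)"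
  and integral_exponential_density: "0 < l \<Longrightarrow> (\<integral>x. exponential_density l x \<partial>lborel) = 1"
proof -
  assume l: "0 < l"
  then interpret prob_space "density lborel (exponential_density l)"
    by (rule prob_space_exponential_density)
  have nn: "AE x in lborel. 0 \<le> exponential_density l x"
    using l by (simp add: exponential_density_nonneg)
  have "(\<integral>\<^sup>+x. ennreal (exponential_density l x) \<partial>lborel) = 1"
    using emeasure_space_1 by (simp add: emeasure_density)
  then have "has_bochner_integral lborel (exponential_density l) 1"
    by (intro has_bochner_integral_nn_integral nn) auto
  then show "integrable lborel (exponential_density l)" "(\<integral>x. exponential_density l x \<partial>lborel) = 1"
    by (auto simp: has_bochner_integral_iff)
qed

lemma exponential_density_tail:
  assumes "0 < l" "0 < v"
  shows "integrable lborel (\<lambda>b. exponential_density l b * indicator {v..} b)"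
    and "(\<integral>b. exponential_density l b * indicator {v..} b \<partial>lborel) = exp (- l * v)"
proof -
  \<comment> \<open>Memorylessness: the density shifted by \<open>v\<close> is the density itself
    times \<open>exp (- l * v)\<close>.\<close>
  have eq: "exponential_density l (v + 1 * b) * indicator {v..} (v + 1 * b)
      = exp (- l * v) * exponential_density l b" for b
    using assms by (auto simp: exponential_density_def indicator_def exp_add[symmetric] algebra_simps)
  show "integrable lborel (\<lambda>b. exponential_density l b * indicator {v..} b)"
    using assms by (intro integrable_real_mult_indicator) auto
  show "(\<integral>b. exponential_density l b * indicator {v..} b \<partial>lborel) = exp (- l * v)"
    by (subst lborel_integral_real_affine[where c=1 and t=v], simp, unfold eq)
       (use assms in \<open>simp add: integral_exponential_density\<close>)
qed

lemma exp_half_line: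
  assumes "0 < Re z"
  shows "integrable lborel (\<lambda>x. if 0 < x then exp (- z * of_real x) else 0)" (is ?I)
    and "(\<integral>x. (if 0 < x then exp (- z * of_real x) else 0) \<partial>lborel) = 1 / z" (is ?E)
proof -
  show I: ?I
  proof (rule Bochner_Integration.integrable_bound)
    show "integrable lborel (\<lambda>x. exponential_density (Re z) x / Re z)" using assms by simp
    show "AE x in lborel. norm (if 0 < x then exp (- z * of_real x) else 0)
        \<le> norm (exponential_density (Re z) x / Re z)"
      using assms by (intro AE_I2) (auto simp: exponential_density_def mult.commute)
  qed simp
  have "((\<lambda>x::real. - exp (- z * of_real x) / z) \<longlongrightarrow> 0) at_top"
  proof (rule tendsto_norm_zero_cancel)
    have "((\<lambda>x::real. exp (- Re z * x)) \<longlongrightarrow> 0) at_top"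
      using assms by real_asymp
    then show "((\<lambda>x::real. norm (- exp (- z * of_real x) / z)) \<longlongrightarrow> 0) at_top"
      by (simp add: norm_divide tendsto_divide_zero)
  qed
  then have lim: "(((\<lambda>x::real. - exp (- z * of_real x) / z) \<circ> real_of_ereal) \<longlongrightarrow> 0) (at_left \<infinity>)"
    unfolding ereal_tendsto_simps1 .
  have lim0: "(((\<lambda>x::real. - exp (- z * of_real x) / z) \<circ> real_of_ereal) \<longlongrightarrow> - 1 / z) (at_right 0)"
    unfolding zero_ereal_def ereal_tendsto_simps1
    using assms by (auto intro!: tendsto_eq_intros)
  have "(LBINT x=0..\<infinity>. exp (- z * of_real x)) = 0 - (- 1 / z)"
  proof (rule interval_integral_FTC_integrable[where F="\<lambda>x. - exp (- z * of_real x) / z"])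
    fix x :: real
    have "z \<noteq> 0" using assms by auto
    then have "((\<lambda>x. - exp (- z * x) / z) has_field_derivative exp (- z * of_real x)) (at (of_real x))"
      by (auto intro!: derivative_eq_intros simp: field_simps)
    then show "((\<lambda>x. - exp (- z * of_real x) / z) has_vector_derivative exp (- z * of_real x)) (at x)"
      by (rule has_vector_derivative_real_field)
    show "isCont (\<lambda>x. exp (- z * of_real x)) x" by (intro continuous_intros)
    show "set_integrable lborel (einterval 0 \<infinity>) (\<lambda>x. exp (- z * of_real x))"
      unfolding set_integrable_def using I
      by (rule Bochner_Integration.integrable_cong[THEN iffD1, rotated -1])
         (auto simp: einterval_def indicator_def zero_ereal_def)
  qed (use lim lim0 in auto)
  also have "(LBINT x=0..\<infinity>. exp (- z * of_real x)) = (\<integral>x. (if 0 < x then exp (- z * of_real x) else 0) \<partial>lborel)"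
    unfolding interval_lebesgue_integral_def set_lebesgue_integral_def
    by (auto intro!: Bochner_Integration.integral_cong simp: einterval_def indicator_def zero_ereal_def)
  finally show ?E by simp
qed

lemma integral_exp_Icc:
  assumes "z \<noteq> (0::complex)" "0 \<le> w"
  shows "(\<integral>u. indicator {0..w} u *\<^sub>R exp (z * of_real u) \<partial>lborel) = (exp (z * of_real w) - 1) / z"
proof -
  have "(\<integral>u. indicator {0..w} u *\<^sub>R exp (z * of_real u) \<partial>lborel)
     = exp (z * of_real w) / z - exp (z * of_real 0) / z"
  proof (rule integral_FTC_Icc)
    fix u :: real
    have "((\<lambda>x. exp (z * x) / z) has_field_derivative exp (z * of_real u)) (at (of_real u))"
      using assms by (auto intro!: derivative_eq_intros simp: field_simps)
    then have "((\<lambda>x. exp (z * of_real x) / z) has_vector_derivative exp (z * of_real u)) (at u)"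
      by (rule has_vector_derivative_real_field)
    then show "((\<lambda>x. exp (z * of_real x) / z) has_vector_derivative exp (z * of_real u)) (at u within {0..w})"
      by (rule has_vector_derivative_at_within)
  qed (use assms in \<open>auto intro!: continuous_intros\<close>)
  then show ?thesis by (simp add: diff_divide_distrib)
qed

lemma exp_bounded_nonneg:
  assumes "exp_bounded f K r" shows "0 \<le> K"
proof -
  have "norm (f 1) \<le> K * exp (- r * 1)"
    using assms unfolding exp_bounded_def by (meson zero_less_one)
  then have "0 \<le> K * exp (- r * 1)" by (rule order_trans[OF norm_ge_zero])
  then show ?thesis by (simp add: zero_le_mult_iff)
qed

lemma exp_bounded_integrable:
  assumes "exp_bounded f K r" "0 < Re z + r"
  shows "integrable lborel (\<lambda>x. exp (- z * of_real x) * f x)"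
    and "norm (laplace f z) \<le> K / (Re z + r)"
proof -
  let ?k = "Re z + r"
  have [measurable]: "f \<in> borel_measurable borel" using assms by (simp add: exp_bounded_def)
  have bnd: "norm (exp (- z * of_real x) * f x) \<le> K / ?k * exponential_density ?k x" for x
  proof (cases "0 < x")
    case True
    then have "norm (exp (- z * of_real x) * f x) \<le> exp (- Re z * x) * (K * exp (- r * x))"
      using assms(1) unfolding norm_mult by (intro mult_mono) (auto simp: exp_bounded_def)
    also have "\<dots> = K * exp (- ?k * x)" by (simp add: exp_add[symmetric] algebra_simps)
    also have "\<dots> = K / ?k * exponential_density ?k x"
    proof -
      have "exponential_density ?k x = ?k * exp (- ?k * x)"
        using True by (simp add: exponential_density_def algebra_simps)
      then show ?thesis using assms(2) by simp
    qed
    finally show ?thesis .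
  next
    case False
    then show ?thesis using assms exp_bounded_nonneg[OF assms(1)]
      by (auto simp: exp_bounded_def exponential_density_def)
  qed
  have int: "integrable lborel (\<lambda>x. K / ?k * exponential_density ?k x)" using assms(2) by simp
  show I: "integrable lborel (\<lambda>x. exp (- z * of_real x) * f x)"
    by (rule Bochner_Integration.integrable_bound[OF int], measurable)
       (intro AE_I2 order_trans[OF bnd], simp only: real_norm_def abs_ge_self)
  have "norm (laplace f z) \<le> (\<integral>x. K / ?k * exponential_density ?k x \<partial>lborel)"
    unfolding laplace_def by (rule order_trans[OF integral_norm_bound])
      (intro integral_mono integrable_norm I int bnd)
  then show "norm (laplace f z) \<le> K / ?k"
    using assms(2) by (simp add: integral_exponential_density)
qed

lemma integral_convolution:
  fixes F G :: "real \<Rightarrow> complex"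
  assumes F: "integrable lborel F" and G: "integrable lborel G"
  shows "integrable lborel (\<lambda>x. \<integral>b. F b * G (x - b) \<partial>lborel)"
    and "(\<integral>x. (\<integral>b. F b * G (x - b) \<partial>lborel) \<partial>lborel) = (\<integral>b. F b \<partial>lborel) * (\<integral>x. G x \<partial>lborel)"
proof -
  have [measurable]: "F \<in> borel_measurable borel" "G \<in> borel_measurable borel" using F G by auto
  have shift: "integrable lborel (\<lambda>x. h (x - b)) \<and> (\<integral>x. h (x - b) \<partial>lborel) = (\<integral>x. h x \<partial>lborel)"
    if "integrable lborel h" for h :: "real \<Rightarrow> 'b::{banach, second_countable_topology}" and b
    using lborel_integrable_real_affine[OF that, of 1 "- b"] lborel_integral_real_affine[of 1 h "- b"]
    by (simp add: add.commute[of "- b"])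
  let ?f = "\<lambda>(b, x). F b * G (x - b)"
  have int: "integrable (lborel \<Otimes>\<^sub>M lborel) ?f"
  proof (rule lborel_pair.Fubini_integrable)
    have "(\<lambda>b. \<integral>x. norm (?f (b, x)) \<partial>lborel) = (\<lambda>b. norm (F b) * (\<integral>x. norm (G x) \<partial>lborel))"
      using shift[OF integrable_norm[OF G]] by (simp add: norm_mult)
    then show "integrable lborel (\<lambda>b. \<integral>x. norm (?f (b, x)) \<partial>lborel)" using F by simp
    show "AE b in lborel. integrable lborel (\<lambda>x. ?f (b, x))" using shift[OF G] by simp
  qed measurable
  show "integrable lborel (\<lambda>x. \<integral>b. F b * G (x - b) \<partial>lborel)"
    using lborel_pair.integrable_snd[OF int] by simp
  have "(\<integral>x. (\<integral>b. F b * G (x - b) \<partial>lborel) \<partial>lborel) = (\<integral>b. (\<integral>x. F b * G (x - b) \<partial>lborel) \<partial>lborel)"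
    using lborel_pair.Fubini_integral[OF int] by simp
  also have "\<dots> = (\<integral>b. F b * (\<integral>x. G x \<partial>lborel) \<partial>lborel)" using shift[OF G] by simp
  finally show "(\<integral>x. (\<integral>b. F b * G (x - b) \<partial>lborel) \<partial>lborel) = (\<integral>b. F b \<partial>lborel) * (\<integral>x. G x \<partial>lborel)"
    by simp
qed

text \<open>The expectation of \<open>f (u + Y)\<close> for an exponential \<open>Y\<close> of rate
  \<open>m\<close>. The cutoff at \<open>u = 0\<close> encodes that a gain counts only if the
  surplus before it is positive, and it keeps the result \<open>exp_bounded\<close>.\<close>

definition exp_average :: "real \<Rightarrow> (real \<Rightarrow> complex) \<Rightarrow> real \<Rightarrow> complex" where
  "exp_average m f u = (if 0 < u then \<integral>y. of_real (exponential_density m y) * f (u + y) \<partial>lborel else 0)"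

lemma exp_average_integrable:
  assumes m: "0 < m" and f: "exp_bounded f K r" and r: "0 \<le> r" and u: "0 < u"
  shows "integrable lborel (\<lambda>y. of_real (exponential_density m y) * f (u + y))"
    and "norm (\<integral>y. of_real (exponential_density m y) * f (u + y) \<partial>lborel) \<le> K * exp (- r * u)"
proof -
  have [measurable]: "f \<in> borel_measurable borel" using f by (simp add: exp_bounded_def)
  note K = exp_bounded_nonneg[OF f]
  have bnd: "norm (of_real (exponential_density m y) * f (u + y))
      \<le> exponential_density m y * (K * exp (- r * u))" for y
  proof (cases "0 \<le> y")
    case True
    then have "norm (f (u + y)) \<le> K * exp (- r * (u + y))" using f u by (simp add: exp_bounded_def)
    also have "\<dots> \<le> K * exp (- r * u)" using True r K by (intro mult_left_mono) (auto intro: mult_left_mono)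
    finally show ?thesis using m by (simp add: norm_mult exponential_density_nonneg mult_left_mono)
  qed (simp add: exponential_density_def)
  have int: "integrable lborel (\<lambda>y. exponential_density m y * (K * exp (- r * u)))" using m by simp
  show I: "integrable lborel (\<lambda>y. of_real (exponential_density m y) * f (u + y))"
    by (rule Bochner_Integration.integrable_bound[OF int]) (auto intro!: AE_I2 order_trans[OF bnd] abs_ge_self)
  have "norm (\<integral>y. of_real (exponential_density m y) * f (u + y) \<partial>lborel)
     \<le> (\<integral>y. exponential_density m y * (K * exp (- r * u)) \<partial>lborel)"
    by (rule order_trans[OF integral_norm_bound]) (intro integral_mono integrable_norm I int bnd)
  then show "norm (\<integral>y. of_real (exponential_density m y) * f (u + y) \<partial>lborel) \<le> K * exp (- r * u)"
    using m by (simp add: integral_exponential_density)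
qed

lemma exp_bounded_exp_average:
  assumes "0 < m" "exp_bounded f K r" "0 \<le> r"
  shows "exp_bounded (exp_average m f) K r"
proof -
  have [measurable]: "f \<in> borel_measurable borel" using assms by (simp add: exp_bounded_def)
  have "exp_average m f \<in> borel_measurable borel"
    unfolding exp_average_def by measurable
  then show ?thesis using exp_average_integrable[OF assms]
    by (auto simp: exp_bounded_def exp_average_def)
qed

text \<open>Substitute \<open>w = u + y\<close> and integrate over \<open>u\<close> first. The inner
  integral of \<open>exp ((m - z) * u)\<close> over \<open>{0..w}\<close> is a difference of two
  exponentials; its upper end yields \<open>laplace f z\<close>, its lower end the boundary term
  \<open>laplace f m\<close>.\<close>

lemma laplace_exp_average:
  assumes m: "0 < m" and f: "exp_bounded f K r" and r: "0 \<le> r"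
    and z: "0 < Re z + r" "z \<noteq> of_real m"
  shows "laplace (exp_average m f) z = of_real m * (laplace f z - laplace f (of_real m)) / (of_real m - z)"
proof -
  have [measurable]: "f \<in> borel_measurable borel" using f by (simp add: exp_bounded_def)
  let ?e = "exponential_density m"
  let ?B = "\<lambda>(u, w). (if 0 < u then exp (- z * of_real u) * (of_real (?e (w - u)) * f w) else 0)"
  have shift: "integrable lborel (\<lambda>w. h (w - u)) \<longleftrightarrow> integrable lborel h"
      "(\<integral>w. h (w - u) \<partial>lborel) = (\<integral>w. h w \<partial>lborel)"
    for h :: "real \<Rightarrow> 'b::{banach, second_countable_topology}" and u
    using lborel_integrable_real_affine_iff[of 1 "\<lambda>w. h w" "- u"] lborel_integral_real_affine[of 1 h "- u"]
    by (simp_all add: add.commute[of "- u"])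
  have inner: "integrable lborel (\<lambda>w. of_real (?e (w - u)) * f w)"
    and inner_eq: "(\<integral>w. of_real (?e (w - u)) * f w \<partial>lborel) = exp_average m f u" if "0 < u" for u
    using exp_average_integrable(1)[OF m f r that]
      shift[of "\<lambda>y. of_real (?e y) * f (u + y)" u] that by (auto simp: exp_average_def)
  have norm_exp_bounded: "exp_bounded (\<lambda>x. of_real (norm (f x))) K r"
    using f by (auto simp: exp_bounded_def)
  have int: "integrable (lborel \<Otimes>\<^sub>M lborel) ?B"
  proof (rule lborel_pair.Fubini_integrable)
    \<comment> \<open>The inner integral of the norms is again an \<open>exp_average\<close>, now of
      \<open>norm (f x)\<close> and with the real exponent \<open>Re z\<close>. So the previous
      bounds give absolute integrability; the cast to complex numbers only matches their
      type.\<close>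
    have eq: "complex_of_real (\<integral>w. norm (?B (u, w)) \<partial>lborel)
        = exp (- of_real (Re z) * of_real u) * exp_average m (\<lambda>x. of_real (norm (f x))) u" for u
    proof (cases "0 < u")
      case True
      have "(\<integral>w. norm (?B (u, w)) \<partial>lborel)
          = (\<integral>w. exp (- Re z * u) * (?e (w - u) * norm (f w)) \<partial>lborel)"
        using True m by (intro Bochner_Integration.integral_cong refl)
          (simp add: norm_mult exponential_density_nonneg)
      also have "\<dots> = exp (- Re z * u) * (\<integral>y. ?e y * norm (f (u + y)) \<partial>lborel)"
        using shift(2)[of "\<lambda>y. ?e y * norm (f (u + y))" u] by simp
      finally show ?thesis using True by (simp add: exp_average_def exp_of_real flip: of_real_mult of_real_minus)
    qed (simp add: exp_average_def)
    have "integrable lborel (\<lambda>u. complex_of_real (\<integral>w. norm (?B (u, w)) \<partial>lborel))"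
      unfolding eq using exp_bounded_integrable(1)[OF exp_bounded_exp_average[OF m norm_exp_bounded r], of "of_real (Re z)"] z
      by simp
    then show "integrable lborel (\<lambda>u. \<integral>w. norm (?B (u, w)) \<partial>lborel)"
      by (simp only: complex_of_real_integrable_eq)
    show "AE u in lborel. integrable lborel (\<lambda>w. ?B (u, w))"
    proof (rule AE_I2)
      show "integrable lborel (\<lambda>w. ?B (u, w))" for u
        using inner[of u] by (cases "0 < u") simp_all
    qed
  qed measurable
  have zm: "z - of_real m \<noteq> 0" using z by simp
  have outer: "(\<integral>u. ?B (u, w) \<partial>lborel)
      = of_real m / (of_real m - z) * (exp (- z * of_real w) * f w - exp (- of_real m * of_real w) * f w)" for w
  proof (cases "0 < w")
    case True
    have "(\<integral>u. ?B (u, w) \<partial>lborel)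
      = (\<integral>u. (of_real m * exp (- of_real m * of_real w) * f w)
           * (indicator {0..w} u *\<^sub>R exp ((of_real m - z) * of_real u)) \<partial>lborel)"
    proof (rule integral_cong_AE)
      show "AE u in lborel. ?B (u, w) = (of_real m * exp (- of_real m * of_real w) * f w)
           * (indicator {0..w} u *\<^sub>R exp ((of_real m - z) * of_real u))"
        \<comment> \<open>The two sides may differ at \<open>u = 0\<close>, which belongs to
          \<open>{0..w}\<close> but not to the range of \<open>u\<close>.\<close>
        using AE_lborel_singleton[of 0]
      proof eventually_elim
        case (elim u)
        have "exp (- z * of_real u) * complex_of_real (exp ((u - w) * m))
            = exp (- of_real m * of_real w) * exp ((of_real m - z) * of_real u)"
          unfolding exp_of_real[symmetric] by (simp add: exp_add[symmetric] algebra_simps)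
        then show ?case using elim by (auto simp: exponential_density_def indicator_def)
      qed
    qed measurable
    also have "\<dots> = of_real m * exp (- of_real m * of_real w) * f w
        * ((exp ((of_real m - z) * of_real w) - 1) / (of_real m - z))"
      by (subst integral_mult_right_zero, subst integral_exp_Icc) (use True zm in auto)
    also have "\<dots> = of_real m / (of_real m - z) * (exp (- z * of_real w) * f w - exp (- of_real m * of_real w) * f w)"
    proof -
      have "exp (- of_real m * of_real w) * exp ((of_real m - z) * of_real w) = exp (- z * of_real w)"
        by (simp add: exp_add[symmetric] algebra_simps)
      then show ?thesis by (simp add: algebra_simps diff_divide_distrib)
    qed
    finally show ?thesis .
  next
    case False
    then have "f w = 0" using f by (simp add: exp_bounded_def)
    then have "?B (u, w) = 0" for u by simp
    then show ?thesis using \<open>f w = 0\<close> by (simp only: integral_zero) simp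
  qed
  have "laplace (exp_average m f) z = (\<integral>u. (\<integral>w. ?B (u, w) \<partial>lborel) \<partial>lborel)"
    unfolding laplace_def
    by (intro Bochner_Integration.integral_cong refl) (auto simp: inner_eq exp_average_def)
  also have "\<dots> = (\<integral>w. (\<integral>u. ?B (u, w) \<partial>lborel) \<partial>lborel)"
    using lborel_pair.Fubini_integral[OF int] by simp
  also have "\<dots> = of_real m / (of_real m - z) * (laplace f z - laplace f (of_real m))"
    unfolding outer laplace_def
    using exp_bounded_integrable(1)[OF f, of z] exp_bounded_integrable(1)[OF f, of "of_real m"] z m r
    by (simp add: Bochner_Integration.integral_diff)
  finally show ?thesis by simp
qed

section \<open>The functional equation\<close>

lemma eq_divide_mult:
  fixes z :: "'a::field"
  assumes "z * g = n / d" "z \<noteq> 0" shows "g = n / (z * d)"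
proof -
  have "g = n / d / z" using assms by (metis nonzero_mult_div_cancel_left)
  then show ?thesis by (simp add: mult.commute)
qed

context fgm_dual_risk
begin

lemma ruin_tau_eq_laplace: "ruin_tau M B C a c s beta = laplace pos_lst beta"
  unfolding ruin_tau_def laplace_def set_lebesgue_integral_def
  by (intro Bochner_Integration.integral_cong refl) (auto simp: pos_lst_def indicator_def)

lemma exp_bounded_pos_lst: "exp_bounded pos_lst 1 (Re s)"
  using norm_lst_le measurable_pos_lst by (auto simp: exp_bounded_def pos_lst_def)

section \<open>Reduction of the copula to independent exponential variables\<close>

definition exp_mean :: "real \<Rightarrow> real \<Rightarrow> (real \<times> real \<Rightarrow> complex) \<Rightarrow> complex" where
  "exp_mean l m f = (\<integral>b. of_real (exponential_density l b)
     * (\<integral>y. of_real (exponential_density m y) * f (b, y) \<partial>lborel) \<partial>lborel)"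

lemma exp_mean_eq_pair_integral:
  assumes l: "0 < l" and m: "0 < m" and [measurable]: "f \<in> borel_measurable borel"
    and bnd: "\<And>z. 0 \<le> fst z \<Longrightarrow> 0 \<le> snd z \<Longrightarrow> norm (f z) \<le> K"
  shows "integrable lborel (\<lambda>z. of_real (exponential_density l (fst z) * exponential_density m (snd z)) * f z)"
    and "(\<integral>z. of_real (exponential_density l (fst z) * exponential_density m (snd z)) * f z \<partial>lborel)
      = exp_mean l m f"
proof -
  let ?p = "\<lambda>z. exponential_density l (fst z) * exponential_density m (snd z)"
  have "integrable (lborel \<Otimes>\<^sub>M lborel) ?p"
  proof (rule lborel_pair.Fubini_integrable)
    show "integrable lborel (\<lambda>x. \<integral>y. norm (?p (x, y)) \<partial>lborel)"
      using l m by (simp add: abs_mult exponential_density_nonneg integral_exponential_density)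
  qed (use m in \<open>auto simp: borel_prod\<close>)
  then have p: "integrable lborel ?p" unfolding lborel_prod .
  show int: "integrable lborel (\<lambda>z. of_real (?p z) * f z)"
  proof (rule Bochner_Integration.integrable_bound)
    show "integrable lborel (\<lambda>z. K * ?p z)" using p by simp
    show "AE z in lborel. norm (of_real (?p z) * f z) \<le> norm (K * ?p z)"
    proof (rule AE_I2)
      fix z :: "real \<times> real"
      have "norm (of_real (?p z) * f z) \<le> K * ?p z"
      proof (cases "0 \<le> fst z \<and> 0 \<le> snd z")
        case True
        then show ?thesis using bnd[of z] l m
          by (simp add: norm_mult exponential_density_nonneg mult_left_mono mult.commute[of K] abs_mult)
      qed (auto simp: exponential_density_def not_le)
      then show "norm (of_real (?p z) * f z) \<le> norm (K * ?p z)"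
        by (rule order_trans) (simp only: real_norm_def abs_ge_self)
    qed
  qed measurable
  have "(\<integral>z. of_real (?p z) * f z \<partial>(lborel \<Otimes>\<^sub>M lborel))
    = (\<integral>b. (\<integral>y. of_real (?p (b, y)) * f (b, y) \<partial>lborel) \<partial>lborel)"
    by (rule lborel_pair.integral_fst'[symmetric]) (use int in \<open>simp only: lborel_prod\<close>)
  then show "(\<integral>z. of_real (?p z) * f z \<partial>lborel) = exp_mean l m f"
    unfolding lborel_prod exp_mean_def by (simp add: mult.assoc)
qed

text \<open>Each bracket of the copula term is a difference of exponential densities of double and
  single rate. Multiplying out gives a signed mixture of four independent pairs, each of which can
  be transformed in closed form.\<close>

lemma fgm_density_eq:
  "fgm_density lam mu theta z =
     (1 + theta) * (exponential_density lam (fst z) * exponential_density mu (snd z))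
     - theta * (exponential_density (2 * lam) (fst z) * exponential_density mu (snd z))
     - theta * (exponential_density lam (fst z) * exponential_density (2 * mu) (snd z))
     + theta * (exponential_density (2 * lam) (fst z) * exponential_density (2 * mu) (snd z))"
  by (auto simp: fgm_density_def exponential_density_def algebra_simps split: prod.splits)

text \<open>With \<open>u\<close> and \<open>v\<close> in \<open>[0, 1]\<close> the copula
  multiplies the independent density by \<open>1 + theta * (2 * u - 1) * (2 * v - 1)\<close>, which
  lies between 0 and 2 for \<open>theta\<close> between -1 and 1.\<close>

lemma fgm_density_bounds:
  "0 \<le> fgm_density lam mu theta z"
  "fgm_density lam mu theta z \<le> 2 * (exponential_density lam (fst z) * exponential_density mu (snd z))"
proof -
  obtain t y where z: "z = (t, y)" by (cases z)
  have "0 \<le> fgm_density lam mu theta (t, y) \<and>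
    fgm_density lam mu theta (t, y) \<le> 2 * (exponential_density lam t * exponential_density mu y)"
  proof (cases "0 \<le> t \<and> 0 \<le> y")
    case True
    define u where "u = exp (- (lam * t))"
    define v where "v = exp (- (mu * y))"
    have uv: "0 < u" "u \<le> 1" "0 < v" "v \<le> 1"
      using True lam_pos mu_pos by (auto simp: u_def v_def)
    have uu: "exp (- (2 * lam * t)) = u * u" "exp (- (2 * mu * y)) = v * v"
      by (simp_all add: u_def v_def exp_add[symmetric])
    have "\<bar>theta * ((2 * u - 1) * (2 * v - 1))\<bar> \<le> 1 * (1 * 1)"
      unfolding abs_mult using uv theta_ge theta_le by (intro mult_mono) auto
    then have k: "0 \<le> 1 + theta * ((2 * u - 1) * (2 * v - 1))" "1 + theta * ((2 * u - 1) * (2 * v - 1)) \<le> 2"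
      by auto
    have f: "fgm_density lam mu theta (t, y) = (lam * u * (mu * v)) * (1 + theta * ((2 * u - 1) * (2 * v - 1)))"
    proof -
      have "fgm_density lam mu theta (t, y)
          = lam * u * (mu * v) + theta * (2 * lam * (u * u) - lam * u) * (2 * mu * (v * v) - mu * v)"
        using True by (simp add: fgm_density_def uu u_def[symmetric] v_def[symmetric])
      then show ?thesis by (simp add: algebra_simps)
    qed
    have e: "exponential_density lam t * exponential_density mu y = lam * u * (mu * v)"
      using True by (simp add: exponential_density_def u_def v_def mult.commute)
    have p: "0 \<le> lam * u * (mu * v)" using uv lam_pos mu_pos by simp
    show ?thesis unfolding f e using k p mult_left_mono[OF k(2) p] by (simp add: mult.commute)
  qed (auto simp: fgm_density_def exponential_density_def)
  then show "0 \<le> fgm_density lam mu theta z"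
    "fgm_density lam mu theta z \<le> 2 * (exponential_density lam (fst z) * exponential_density mu (snd z))"
    by (simp_all add: z)
qed

lemma integral_gain_law:
  assumes [measurable]: "f \<in> borel_measurable borel"
    and bnd: "\<And>z. 0 \<le> fst z \<Longrightarrow> 0 \<le> snd z \<Longrightarrow> norm (f z) \<le> K"
  shows "(\<integral>z. f z \<partial>gain_law)
     = of_real (1 + theta) * exp_mean lam mu f - of_real theta * exp_mean (2 * lam) mu f
       - of_real theta * exp_mean lam (2 * mu) f + of_real theta * exp_mean (2 * lam) (2 * mu) f"
proof -
  let ?p = "\<lambda>l m z. of_real (exponential_density l (fst z) * exponential_density m (snd z)) * f z"
  note P = exp_mean_eq_pair_integral[OF _ _ assms]
  have "(\<integral>z. f z \<partial>gain_law) = (\<integral>z. fgm_density lam mu theta z *\<^sub>R f z \<partial>lborel)"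
    unfolding gain_law_def by (rule integral_density) (auto simp: fgm_density_bounds)
  also have "\<dots> = (\<integral>z. of_real (1 + theta) * ?p lam mu z - of_real theta * ?p (2 * lam) mu z
       - of_real theta * ?p lam (2 * mu) z + of_real theta * ?p (2 * lam) (2 * mu) z \<partial>lborel)"
    by (intro Bochner_Integration.integral_cong refl)
      (simp add: fgm_density_eq scaleR_conv_of_real algebra_simps)
  also have "\<dots> = of_real (1 + theta) * exp_mean lam mu f - of_real theta * exp_mean (2 * lam) mu f
       - of_real theta * exp_mean lam (2 * mu) f + of_real theta * exp_mean (2 * lam) (2 * mu) f"
    using P lam_pos mu_pos by (subst Bochner_Integration.integral_add Bochner_Integration.integral_diff; (simp; fail)?)+
  finally show ?thesis .
qed

definition discounted_gap :: "real \<Rightarrow> real \<Rightarrow> complex" where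
  "discounted_gap l b = of_real (exponential_density l b) * exp (- s * of_real b)"

definition mean_after_gain :: "real \<Rightarrow> real \<Rightarrow> complex" where
  "mean_after_gain m v = exp_average m pos_lst ((1 + a) * v)"

text \<open>The part of the renewal integral in which the gain precedes ruin, for independent rates
  \<open>l\<close> and \<open>m\<close>. Separating the factor for the waiting time
  \<open>c * x\<close> leaves a convolution at \<open>(1 - c) * x\<close>.\<close>

definition gain_contribution :: "real \<Rightarrow> real \<Rightarrow> real \<Rightarrow> complex" where
  "gain_contribution l m x = exp (- s * of_real (c * x))
     * (\<integral>b. discounted_gap l b * mean_after_gain m ((1 - c) * x - b) \<partial>lborel)"

lemma measurable_mean_after_gain[measurable]:
  assumes "0 < m" shows "mean_after_gain m \<in> borel_measurable borel"
proof -
  have [measurable]: "exp_average m pos_lst \<in> borel_measurable borel"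
    using exp_bounded_exp_average[OF assms exp_bounded_pos_lst Re_s_nonneg] by (simp add: exp_bounded_def)
  show ?thesis unfolding mean_after_gain_def by measurable
qed

lemma norm_mean_after_gain_le: 
  assumes "0 < m" shows "norm (mean_after_gain m v) \<le> 1"
proof -
  have "norm (exp_average m pos_lst u) \<le> 1" for u
  proof (cases "0 < u")
    case True
    then have "norm (exp_average m pos_lst u) \<le> exp (- Re s * u)"
      using exp_bounded_exp_average[OF assms exp_bounded_pos_lst Re_s_nonneg] by (simp add: exp_bounded_def)
    also have "\<dots> \<le> 1" using True Re_s_nonneg by simp
    finally show ?thesis .
  qed (simp add: exp_average_def)
  then show ?thesis by (simp add: mean_after_gain_def)
qed

lemma exp_mean_gain_step:
  assumes l: "0 < l" and m: "0 < m" and x: "0 < x"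
  shows "exp_mean l m (gain_step pos_lst x)
    = exp (- s * of_real x) * of_real (exp (- l * ((1 - c) * x))) + gain_contribution l m x"
proof -
  let ?v = "(1 - c) * x"
  have v: "0 < ?v" using x c_less_1 by simp
  have inner: "(\<integral>y. of_real (exponential_density m y) * gain_step pos_lst x (b, y) \<partial>lborel)
     = (if ?v \<le> b then exp (- s * of_real x)
        else exp (- s * of_real (c * x + b)) * mean_after_gain m (?v - b))" for b
  proof (cases "?v \<le> b")
    case True
    then show ?thesis using m by (simp add: gain_step_def integral_exponential_density)
  next
    case False
    have "(\<integral>y. of_real (exponential_density m y) * gain_step pos_lst x (b, y) \<partial>lborel)
      = (\<integral>y. exp (- s * of_real (c * x + b))
          * (of_real (exponential_density m y) * pos_lst ((1 + a) * (?v - b) + y)) \<partial>lborel)"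
      using False by (intro Bochner_Integration.integral_cong refl) (simp add: gain_step_def next_level_def)
    also have "\<dots> = exp (- s * of_real (c * x + b)) * mean_after_gain m (?v - b)"
      using False a_nonneg by (simp add: mean_after_gain_def exp_average_def)
    finally show ?thesis using False by simp
  qed
  let ?f = "\<lambda>b. exp (- s * of_real x) * of_real (exponential_density l b * indicator {?v..} b)"
  let ?g = "\<lambda>b. exp (- s * of_real (c * x)) * (discounted_gap l b * mean_after_gain m (?v - b))"
  have eq: "of_real (exponential_density l b) * (\<integral>y. of_real (exponential_density m y) * gain_step pos_lst x (b, y) \<partial>lborel)
     = ?f b + ?g b" for b
  proof (cases "?v \<le> b")
    case True
    \<comment> \<open>On this range the surplus before the gain is not positive, and the cutoff in
      \<open>exp_average\<close> makes the gain part vanish. So both parts can be added without a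
      case distinction.\<close>
    then have "mean_after_gain m (?v - b) = 0"
      using a_nonneg by (auto simp: mean_after_gain_def exp_average_def mult_pos_pos zero_less_mult_iff)
    then show ?thesis unfolding inner using True by simp
  next
    case False
    then show ?thesis unfolding inner
      by (simp add: discounted_gap_def exp_add distrib_left exp_diff exp_minus field_simps)
  qed
  have f: "integrable lborel ?f" using exponential_density_tail(1)[OF l v] by (intro integrable_mult_right integrable_of_real)
  have g: "integrable lborel ?g"
  proof (rule integrable_mult_right, rule Bochner_Integration.integrable_bound)
    show "integrable lborel (exponential_density l)" using l by simp
    show "AE b in lborel. norm (discounted_gap l b * mean_after_gain m (?v - b)) \<le> norm (exponential_density l b)"
    proof (rule AE_I2)
      fix b
      have "norm (exp (- s * of_real b)) * norm (mean_after_gain m (?v - b)) \<le> 1" if "0 \<le> b"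
        using that Re_s_nonneg norm_mean_after_gain_le[OF m] by (intro mult_le_one) auto
      then show "norm (discounted_gap l b * mean_after_gain m (?v - b)) \<le> norm (exponential_density l b)"
        unfolding discounted_gap_def norm_mult norm_of_real real_norm_def mult.assoc
        by (cases "0 \<le> b") (auto simp: exponential_density_def intro!: mult_left_le)
    qed
    show "(\<lambda>b. discounted_gap l b * mean_after_gain m (?v - b)) \<in> borel_measurable lborel"
      using m unfolding discounted_gap_def by measurable
  qed
  show ?thesis
    unfolding exp_mean_def eq Bochner_Integration.integral_add[OF f g] gain_contribution_def
      integral_mult_right_zero integral_complex_of_real exponential_density_tail(2)[OF l v] ..
qed

lemma gain_contribution_nonpos: "x \<le> 0 \<Longrightarrow> gain_contribution l m x = 0"
proof -
  assume x: "x \<le> 0"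
  have "discounted_gap l b * mean_after_gain m ((1 - c) * x - b) = 0" for b
  proof (cases "0 \<le> b")
    case True
    have "(1 - c) * x \<le> 0" using x c_less_1 by (simp add: mult_nonneg_nonpos)
    then have "(1 + a) * ((1 - c) * x - b) \<le> 0" using True a_nonneg by (intro mult_nonneg_nonpos) auto
    then show ?thesis by (simp add: mean_after_gain_def exp_average_def)
  qed (simp add: discounted_gap_def exponential_density_def)
  then show ?thesis unfolding gain_contribution_def by (simp only: integral_zero mult_zero_right)
qed

text \<open>In the term for ruin before any gain all contributions of \<open>theta\<close> cancel,
  because the four weights belonging to \<open>lam\<close> and \<open>2 * lam\<close> sum to 1 and
  0: the marginal law of the gap is exponential of rate \<open>lam\<close>.\<close>

lemma pos_lst_decomposition:
  "pos_lst x = (if 0 < x then exp (- (s + of_real (lam * (1 - c))) * of_real x) else 0)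
     + of_real (1 + theta) * gain_contribution lam mu x
     - of_real theta * gain_contribution (2 * lam) mu x
     - of_real theta * gain_contribution lam (2 * mu) x
     + of_real theta * gain_contribution (2 * lam) (2 * mu) x"
proof (cases "0 < x")
  case True
  have one: "norm (pos_lst y) \<le> 1" if "0 < y" for y
    by (rule order_trans[OF norm_pos_lst_le]) (use that Re_s_nonneg in simp)
  have "lst x = (\<integral>z. gain_step pos_lst x z \<partial>gain_law)" by (rule lst_renewal[OF True])
  also have "\<dots> = of_real (1 + theta) * exp_mean lam mu (gain_step pos_lst x)
      - of_real theta * exp_mean (2 * lam) mu (gain_step pos_lst x)
      - of_real theta * exp_mean lam (2 * mu) (gain_step pos_lst x)
      + of_real theta * exp_mean (2 * lam) (2 * mu) (gain_step pos_lst x)"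
    by (rule integral_gain_law[where K=1]) (auto intro!: norm_gain_step_le True one)
  finally have lst: "lst x = \<dots>" .
  let ?v = "(1 - c) * x"
  let ?x = "\<lambda>l. exp (- s * of_real x) * complex_of_real (exp (- l * ?v))"
  have "exp (- (s + of_real (lam * (1 - c))) * of_real x) = ?x lam"
    unfolding exp_of_real[symmetric] exp_add[symmetric] by (rule arg_cong[where f=exp]) (simp add: algebra_simps)
  then show ?thesis
    using True lam_pos mu_pos unfolding pos_lst_def
    by (simp only: if_True lst exp_mean_gain_step mult_pos_pos zero_less_numeral) (simp add: algebra_simps)
qed (simp add: gain_contribution_nonpos pos_lst_def)

text \<open>By the choice of \<open>rr\<close>, \<open>exp (- beta * x) * exp (- s * c * x)\<close>
  equals \<open>exp (- r * b) * exp (- r * ((1 - c) * x - b))\<close>, so the integrand is a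
  convolution \<open>?F * ?G\<close> at \<open>(1 - c) * x\<close> and its integral factors.
  Rescaling by \<open>1 - c\<close> gives the first denominator; rescaling \<open>?G\<close> by
  \<open>1 + a\<close> turns \<open>r\<close> into \<open>psi\<close> and leads to
  \<open>laplace_exp_average\<close>.\<close>

lemma laplace_gain_contribution:
  assumes l: "0 < l" and m: "0 < m" and beta: "0 < Re (s + beta)" and np: "psi a c s beta \<noteq> of_real m"
  shows "integrable lborel (\<lambda>x. exp (- beta * of_real x) * gain_contribution l m x)"
    and "laplace (gain_contribution l m) beta
      = of_real l / (s + beta + of_real (l * (1 - c))) * of_real m / (of_real (m * (1 + a)) - rr c s beta)
        * (laplace pos_lst (psi a c s beta) - laplace pos_lst (of_real m))"
proof -
  let ?r = "rr c s beta" and ?psi = "psi a c s beta"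
  let ?cb = "1 - c"
  have cb: "0 < ?cb" using c_less_1 by simp
  have a1: "0 < 1 + a" using a_nonneg by simp
  have r: "of_real ?cb * ?r = beta + of_real c * s" using cb by (simp add: rr_def)
  have psir: "of_real (1 + a) * ?psi = ?r" using a1 by (simp add: psi_def flip: of_real_add)
  have Rer: "?cb * Re ?r = Re beta + c * Re s"
    using arg_cong[OF r, of Re] by simp
  \<comment> \<open>Positivity of \<open>Re (s + beta)\<close> passes to \<open>Re r + Re s\<close>,
    needed for \<open>?F\<close>, and by \<open>0 <= a * Re s\<close> on to
    \<open>Re psi + Re s\<close>, needed for \<open>?H\<close> and thus for
    \<open>?G\<close>.\<close>
  have "?cb * (Re ?r + Re s) = Re (s + beta)" unfolding distrib_left Rer by (simp add: algebra_simps)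
  then have Rers: "0 < Re ?r + Re s" using beta cb by (metis zero_less_mult_pos)
  have Repsi: "(1 + a) * Re ?psi = Re ?r"
    using arg_cong[OF psir, of Re] by simp
  have "0 < (1 + a) * (Re ?psi + Re s)"
    unfolding distrib_left Repsi using Rers mult_nonneg_nonneg[OF a_nonneg Re_s_nonneg]
    by (simp add: algebra_simps)
  then have Repsis: "0 < Re ?psi + Re s" using a1 by (simp add: zero_less_mult_iff)
  let ?F = "\<lambda>b. exp (- ?r * of_real b) * discounted_gap l b"
  let ?G = "\<lambda>v. exp (- ?r * of_real v) * mean_after_gain m v"
  let ?H = "\<lambda>u. exp (- ?psi * of_real u) * exp_average m pos_lst u"
  let ?k = "?r + s + of_real l"
  have k: "0 < Re ?k" using Rers l by simp
  have Feq: "AE b in lborel. ?F b = of_real l * (if 0 < b then exp (- ?k * of_real b) else 0)"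
    using AE_lborel_singleton[of 0]
  proof eventually_elim
    case (elim b)
    have "exp (- ?r * of_real b) * (complex_of_real (exp (- b * l)) * exp (- s * of_real b)) = exp (- ?k * of_real b)"
      unfolding exp_of_real[symmetric] exp_add[symmetric] by (rule arg_cong[where f=exp]) (simp add: algebra_simps)
    then show ?case using elim
      by (auto simp: discounted_gap_def exponential_density_def)
  qed
  have [measurable]: "?F \<in> borel_measurable lborel" unfolding discounted_gap_def by measurable
  have F1: "integrable lborel ?F"
  proof (subst integrable_cong_AE[OF _ _ Feq])
    show "integrable lborel (\<lambda>b. of_real l * (if 0 < b then exp (- ?k * of_real b) else 0))"
      using exp_half_line(1)[OF k] by (rule integrable_mult_right)
  qed measurable
  have "(\<integral>b. ?F b \<partial>lborel) = (\<integral>b. of_real l * (if 0 < b then exp (- ?k * of_real b) else 0) \<partial>lborel)"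
    by (rule integral_cong_AE[OF _ _ Feq]) measurable
  also have "\<dots> = of_real l * (1 / ?k)"
    unfolding integral_mult_right_zero exp_half_line(2)[OF k] ..
  finally have F2: "(\<integral>b. ?F b \<partial>lborel) = of_real l / ?k" by simp
  have GH: "?G = (\<lambda>v. ?H (0 + (1 + a) * v))"
    unfolding psir[symmetric] by (auto simp: mean_after_gain_def mult_ac)
  have H: "integrable lborel ?H"
    using exp_bounded_integrable(1)[OF exp_bounded_exp_average[OF m exp_bounded_pos_lst Re_s_nonneg]] Repsis by simp
  have G: "integrable lborel ?G"
    unfolding GH using H a1 by (intro lborel_integrable_real_affine) auto
  have "(\<integral>u. ?H u \<partial>lborel) = of_real m * (laplace pos_lst ?psi - laplace pos_lst (of_real m)) / (of_real m - ?psi)"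
    using laplace_exp_average[OF m exp_bounded_pos_lst Re_s_nonneg Repsis np] unfolding laplace_def .
  moreover have "(\<integral>u. ?H u \<partial>lborel) = (1 + a) *\<^sub>R (\<integral>v. ?G v \<partial>lborel)"
    unfolding GH using lborel_integral_real_affine[of "1 + a" ?H 0] a1 by simp
  ultimately have Gi: "of_real (1 + a) * (\<integral>v. ?G v \<partial>lborel)
      = of_real m * (laplace pos_lst ?psi - laplace pos_lst (of_real m)) / (of_real m - ?psi)"
    by (simp add: scaleR_conv_of_real)
  let ?h = "\<lambda>X. \<integral>b. ?F b * ?G (X - b) \<partial>lborel"
  note conv = integral_convolution[OF F1 G]
  have eq: "exp (- beta * of_real x) * gain_contribution l m x = ?h (0 + ?cb * x)" for x
  proof -
    have e: "?F b * ?G (0 + ?cb * x - b) = (exp (- beta * of_real x) * exp (- s * of_real (c * x)))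
       * (discounted_gap l b * mean_after_gain m (?cb * x - b))" for b
    proof -
      have "exp (- ?r * of_real b) * exp (- ?r * of_real (?cb * x - b)) = exp (- (of_real ?cb * ?r) * of_real x)"
        by (simp add: exp_add[symmetric] algebra_simps)
      also have "\<dots> = exp (- beta * of_real x) * exp (- s * of_real (c * x))"
        unfolding r by (simp add: exp_add[symmetric] algebra_simps)
      finally show ?thesis by (simp add: mult_ac)
    qed
    show ?thesis unfolding e integral_mult_right_zero gain_contribution_def by (simp only: mult.assoc)
  qed
  show "integrable lborel (\<lambda>x. exp (- beta * of_real x) * gain_contribution l m x)"
    unfolding eq using conv(1) cb by (intro lborel_integrable_real_affine) auto
  have cbn: "complex_of_real ?cb \<noteq> 0" and an: "complex_of_real (1 + a) \<noteq> 0"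
    unfolding of_real_eq_0_iff using cb a1 by auto
  have "of_real l / ?k * (\<integral>v. ?G v \<partial>lborel) = (\<integral>X. ?h X \<partial>lborel)"
    using conv(2) F2 by simp
  also have "\<dots> = of_real ?cb * laplace (gain_contribution l m) beta"
    unfolding laplace_def eq using lborel_integral_real_affine[of ?cb ?h 0] cb
    by (simp add: scaleR_conv_of_real)
  finally have "of_real ?cb * laplace (gain_contribution l m) beta = of_real l * (\<integral>v. ?G v \<partial>lborel) / ?k"
    by simp
  from eq_divide_mult[OF this cbn]
  have L: "laplace (gain_contribution l m) beta = of_real l / (of_real ?cb * ?k) * (\<integral>v. ?G v \<partial>lborel)"
    by simp
  have "of_real ?cb * ?k = s + beta + of_real (l * ?cb)"
    unfolding distrib_left r by (simp add: algebra_simps)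
  moreover have "(\<integral>v. ?G v \<partial>lborel)
     = of_real m * (laplace pos_lst ?psi - laplace pos_lst (of_real m)) / (of_real (1 + a) * (of_real m - ?psi))"
    by (rule eq_divide_mult[OF Gi an])
  moreover have "of_real (1 + a) * (of_real m - ?psi) = of_real (m * (1 + a)) - ?r"
    unfolding right_diff_distrib psir by simp
  ultimately show "laplace (gain_contribution l m) beta
      = of_real l / (s + beta + of_real (l * (1 - c))) * of_real m / (of_real (m * (1 + a)) - rr c s beta)
        * (laplace pos_lst (psi a c s beta) - laplace pos_lst (of_real m))"
    unfolding L by simp
qed

lemma laplace_pos_lst_equation:
  assumes beta: "0 < Re (s + beta)"
    and np: "psi a c s beta \<noteq> of_real mu" "psi a c s beta \<noteq> of_real (2 * mu)"
  defines "D \<equiv> \<lambda>l. s + beta + of_real (l * (1 - c))"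
    and "E \<equiv> \<lambda>m. of_real (m * (1 + a)) - rr c s beta"
    and "dt \<equiv> \<lambda>m. laplace pos_lst (psi a c s beta) - laplace pos_lst (of_real m)"
  shows "laplace pos_lst beta = 1 / D lam
     + of_real (1 + theta) * (of_real lam / D lam * of_real mu / E mu * dt mu)
     - of_real theta * (of_real (2 * lam) / D (2 * lam) * of_real mu / E mu * dt mu)
     - of_real theta * (of_real lam / D lam * of_real (2 * mu) / E (2 * mu) * dt (2 * mu))
     + of_real theta * (of_real (2 * lam) / D (2 * lam) * of_real (2 * mu) / E (2 * mu) * dt (2 * mu))"
proof -
  have pos: "0 < 2 * lam" "0 < 2 * mu" using lam_pos mu_pos by auto
  let ?e = "\<lambda>l m x. exp (- beta * of_real x) * gain_contribution l m x"
  let ?z = "s + beta + of_real (lam * (1 - c))"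
  have z: "0 < Re ?z" using beta lam_pos c_less_1 by (simp add: add_pos_pos)
  let ?q = "\<lambda>x. if 0 < x then exp (- ?z * of_real x) else 0"
  note I = laplace_gain_contribution(1)[OF lam_pos mu_pos beta np(1)] laplace_gain_contribution(1)[OF pos(1) mu_pos beta np(1)]
    laplace_gain_contribution(1)[OF lam_pos pos(2) beta np(2)] laplace_gain_contribution(1)[OF pos beta np(2)]
  note L = laplace_gain_contribution(2)[OF lam_pos mu_pos beta np(1)] laplace_gain_contribution(2)[OF pos(1) mu_pos beta np(1)]
    laplace_gain_contribution(2)[OF lam_pos pos(2) beta np(2)] laplace_gain_contribution(2)[OF pos beta np(2)]
  have "exp (- beta * of_real x) * pos_lst x
     = ?q x + of_real (1 + theta) * ?e lam mu x - of_real theta * ?e (2 * lam) mu x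
       - of_real theta * ?e lam (2 * mu) x + of_real theta * ?e (2 * lam) (2 * mu) x" for x
    by (subst pos_lst_decomposition) (simp add: algebra_simps exp_add[symmetric])
  then have "laplace pos_lst beta = (\<integral>x. ?q x + of_real (1 + theta) * ?e lam mu x - of_real theta * ?e (2 * lam) mu x
       - of_real theta * ?e lam (2 * mu) x + of_real theta * ?e (2 * lam) (2 * mu) x \<partial>lborel)"
    unfolding laplace_def by simp
  also have "\<dots> = 1 / ?z + of_real (1 + theta) * laplace (gain_contribution lam mu) beta
     - of_real theta * laplace (gain_contribution (2 * lam) mu) beta
     - of_real theta * laplace (gain_contribution lam (2 * mu)) beta
     + of_real theta * laplace (gain_contribution (2 * lam) (2 * mu)) beta"
    using I exp_half_line[OF z] unfolding laplace_def
    by (simp del: of_real_add add: Bochner_Integration.integral_add Bochner_Integration.integral_diff)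
  finally show ?thesis unfolding L D_def E_def dt_def .
qed

end

section \<open>Iteration of the functional equation\<close>

definition coef_mu :: "real \<Rightarrow> real \<Rightarrow> real \<Rightarrow> real \<Rightarrow> real \<Rightarrow> complex \<Rightarrow> complex \<Rightarrow> complex" where
  "coef_mu lam mu a c theta s beta =
     of_real (lam * mu) * ((s + beta) * of_real (1 - theta) + of_real (2 * lam * (1 - c)))
     / ((s + of_real (lam * (1 - c)) + beta) * (s + of_real (2 * lam * (1 - c)) + beta)
        * (of_real (mu * (1 + a)) - rr c s beta))"

definition coef_2mu :: "real \<Rightarrow> real \<Rightarrow> real \<Rightarrow> real \<Rightarrow> real \<Rightarrow> complex \<Rightarrow> complex \<Rightarrow> complex" where
  "coef_2mu lam mu a c theta s beta =
     of_real (lam * mu) * (2 * of_real theta * (s + beta))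
     / ((s + of_real (lam * (1 - c)) + beta) * (s + of_real (2 * lam * (1 - c)) + beta)
        * (of_real (2 * mu * (1 + a)) - rr c s beta))"

text \<open>The renewal equation contains the transform at \<open>psi\<close> only in its
  differences from the values at \<open>mu\<close> and \<open>2 * mu\<close>, with the factors
  \<open>coef_mu\<close> and \<open>coef_2mu\<close>. So the sum of these factors multiplies the
  value at \<open>psi\<close>, while each alone is minus the slope of \<open>H_tilde\<close> in one
  unknown.\<close>

lemma J_tilde_eq_coefs:
  assumes "s + of_real (lam * (1 - c)) + beta \<noteq> 0" "s + of_real (2 * lam * (1 - c)) + beta \<noteq> 0"
    and "of_real (mu * (1 + a)) - rr c s beta \<noteq> 0" "of_real (2 * mu * (1 + a)) - rr c s beta \<noteq> 0"
  shows "J_tilde lam mu a c theta s beta = coef_mu lam mu a c theta s beta + coef_2mu lam mu a c theta s beta"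
proof -
  have gen: "L * (D2 * E2 - t * x * r) / (D2 * E2 * D1 * E1)
     = L * (x * (1 - t) + k) / (D1 * D2 * E1) + L * (2 * t * x) / (D1 * D2 * E2)"
    if "D1 \<noteq> 0" "D2 \<noteq> 0" "E1 \<noteq> 0" "E2 \<noteq> 0" "D2 = x + k" "E1 = w - r" "E2 = 2 * w - r"
    for L D1 D2 E1 E2 t x r k w :: complex
  proof -
    have "L * (x * (1 - t) + k) / (D1 * D2 * E1) + L * (2 * t * x) / (D1 * D2 * E2)
      = (L * (x * (1 - t) + k) * E2 + L * (2 * t * x) * E1) / (D2 * E2 * D1 * E1)"
      using that(1-4) by (simp add: divide_simps)
    also have "L * (x * (1 - t) + k) * E2 + L * (2 * t * x) * E1 = L * (D2 * E2 - t * x * r)"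
      unfolding that(5-7) by (simp add: algebra_simps)
    finally show ?thesis by simp
  qed
  show ?thesis unfolding J_tilde_def coef_mu_def coef_2mu_def
    using gen[OF assms, of "s + beta" "of_real (2 * lam * (1 - c))" "of_real (mu * (1 + a))" "rr c s beta"
        "of_real (lam * mu)" "of_real theta"]
    by (simp add: add_ac mult_ac)
qed

lemma H_tilde_eq_coefs:
  "H_tilde lam mu a c theta u v s beta = 1 / (s + of_real (lam * (1 - c)) + beta)
     - coef_mu lam mu a c theta s beta * u - coef_2mu lam mu a c theta s beta * v"
proof -
  have gen: "1 / d * (1 - l * (n1 / (e * f) * u + n2 / (e * g) * v))
      = 1 / d - l * n1 / (d * e * f) * u - l * n2 / (d * e * g) * v" for d e f g l n1 n2 :: complex
    by (simp add: right_diff_distrib distrib_left mult.assoc)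
  show ?thesis unfolding H_tilde_def coef_mu_def coef_2mu_def by (rule gen)
qed

text \<open>The four copula terms are grouped by gain rate, and in each group the two gap rates are
  brought over \<open>D1 * D2\<close>. For gain rate \<open>2 * mu\<close> the multiples of
  \<open>k\<close> cancel, leaving \<open>2 * t * x\<close>.\<close>

lemma coefs_collect:
  fixes l m x t k dm dn :: complex
  assumes "D1 \<noteq> 0" "D2 \<noteq> 0" "D1 = x + k" "D2 = x + 2 * k"
  shows "(1 + t) * (l / D1 * m / E1 * dm) - t * (2 * l / D2 * m / E1 * dm)
     - t * (l / D1 * (2 * m) / E2 * dn) + t * (2 * l / D2 * (2 * m) / E2 * dn)
     = (l * m) * (x * (1 - t) + 2 * k) / (D1 * D2 * E1) * dm + (l * m) * (2 * t * x) / (D1 * D2 * E2) * dn"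
proof -
  have n: "(1 + t) * D2 - (2 * t) * D1 = x * (1 - t) + 2 * k" "(4 * t) * D1 - (2 * t) * D2 = 2 * t * x"
    unfolding assms(3,4) by (simp_all add: algebra_simps)
  have f: "(1 + t) / D1 - 2 * t / D2 = (x * (1 - t) + 2 * k) / (D1 * D2)"
    "4 * t / D2 - 2 * t / D1 = 2 * t * x / (D1 * D2)"
    using diff_frac_eq[OF assms(1,2), of "1 + t" "2 * t"] diff_frac_eq[OF assms(2,1), of "4 * t" "2 * t"]
    unfolding n by (simp_all add: mult.commute)
  have "(1 + t) * (l / D1 * m / E1 * dm) - t * (2 * l / D2 * m / E1 * dm)
     - t * (l / D1 * (2 * m) / E2 * dn) + t * (2 * l / D2 * (2 * m) / E2 * dn)
     = ((1 + t) / D1 - 2 * t / D2) * (l * m / E1 * dm) + (4 * t / D2 - 2 * t / D1) * (l * m / E2 * dn)"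
    by (simp add: algebra_simps)
  also have "\<dots> = (l * m) * (x * (1 - t) + 2 * k) / (D1 * D2 * E1) * dm + (l * m) * (2 * t * x) / (D1 * D2 * E2) * dn"
    unfolding f by (simp add: mult.commute mult.left_commute)
  finally show ?thesis .
qed

text \<open>One vanishing factor annihilates all later terms, hence no bound on \<open>h\<close> is
  asked for in that case. Otherwise the ratio test is applied to the products alone and
  \<open>h\<close> enters by comparison.\<close>

lemma summable_prod_mult:
  fixes J h :: "nat \<Rightarrow> complex"
  assumes "(\<exists>j. J j = 0) \<or> (\<exists>r<1. eventually (\<lambda>j. norm (J j) \<le> r) sequentially)
      \<and> eventually (\<lambda>k. norm (h k) \<le> K) sequentially"
  shows "summable (\<lambda>k. (\<Prod>j<k. J j) * h k)"
proof (cases "\<exists>j. J j = 0")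
  case True
  then obtain j where "J j = 0" by blast
  then have "(\<Prod>j<k. J j) * h k = 0" if "k \<notin> {..j}" for k using that by (auto intro: prod_zero)
  then show ?thesis by (intro summable_finite[of "{..j}"]) auto
next
  case False
  then obtain r where r: "r < 1" "eventually (\<lambda>j. norm (J j) \<le> r) sequentially"
    and h: "eventually (\<lambda>k. norm (h k) \<le> K) sequentially" using assms by blast
  obtain N where N: "\<And>j. j \<ge> N \<Longrightarrow> norm (J j) \<le> r" using r(2) by (auto simp: eventually_sequentially)
  have "summable (\<lambda>k. norm (\<Prod>j<k. J j))"
  proof (rule summable_ratio_test[OF r(1)])
    fix n assume "n \<ge> N"
    then have "norm (J n) * norm (\<Prod>j<n. J j) \<le> r * norm (\<Prod>j<n. J j)" by (intro mult_right_mono N) auto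
    then show "norm (norm (\<Prod>j<Suc n. J j)) \<le> r * norm (norm (\<Prod>j<n. J j))"
      by (simp add: norm_mult mult.commute)
  qed
  then have "summable (\<lambda>k. norm (\<Prod>j<k. J j) * K)" by (rule summable_mult2)
  moreover have "eventually (\<lambda>k. norm ((\<Prod>j<k. J j) * h k) \<le> norm (\<Prod>j<k. J j) * K) sequentially"
    using h by eventually_elim (simp add: norm_mult mult_left_mono)
  ultimately show ?thesis by (rule summable_comparison_test_ev[rotated])
qed

lemma psi_iter_0[simp]: "psi_iter a c s 0 beta = beta"
  and psi_iter_Suc: "psi_iter a c s (Suc j) beta = psi a c s (psi_iter a c s j beta)"
  by (simp_all add: psi_iter_def)

context fgm_dual_risk
begin

lemma integrable_exp_gap: "integrable gain_law (\<lambda>z. exp (lam / 2 * fst z))"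
proof -
  have "complex_integrable lborel (\<lambda>z. of_real (exponential_density (lam / 2) (fst z) * exponential_density mu (snd z)) * 1)"
    by (rule exp_mean_eq_pair_integral(1)[where K=1]) (use lam_pos mu_pos in auto)
  \<comment> \<open>The constant 4 is the 2 of \<open>fgm_density_bounds\<close> times the 2 from
    writing \<open>lam * exp (- lam * t) * exp (lam / 2 * t)\<close> as a density of rate
    \<open>lam / 2\<close>.\<close>
  then have 1: "integrable lborel (\<lambda>z::real \<times> real. 4 * (exponential_density (lam / 2) (fst z) * exponential_density mu (snd z)))"
    by (simp only: mult_1_right complex_of_real_integrable_eq integrable_mult_right)
  have "integrable lborel (\<lambda>z. fgm_density lam mu theta z *\<^sub>R exp (lam / 2 * fst z))"
  proof (rule Bochner_Integration.integrable_bound[OF 1])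
    show "AE z in lborel. norm (fgm_density lam mu theta z *\<^sub>R exp (lam / 2 * fst z))
        \<le> norm (4 * (exponential_density (lam / 2) (fst z) * exponential_density mu (snd z)))"
    proof (rule AE_I2)
      fix z :: "real \<times> real"
      have "norm (fgm_density lam mu theta z *\<^sub>R exp (lam / 2 * fst z))
          = fgm_density lam mu theta z * exp (lam / 2 * fst z)"
        using fgm_density_bounds(1) by simp
      also have "\<dots> \<le> 2 * (exponential_density lam (fst z) * exponential_density mu (snd z)) * exp (lam / 2 * fst z)"
        by (intro mult_right_mono fgm_density_bounds) simp
      also have "\<dots> = 4 * (exponential_density (lam / 2) (fst z) * exponential_density mu (snd z))"
      proof -
        have "exponential_density lam (fst z) * exp (lam / 2 * fst z) = 2 * exponential_density (lam / 2) (fst z)"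
          by (auto simp: exponential_density_def exp_add[symmetric] algebra_simps)
        then show ?thesis by (simp add: algebra_simps)
      qed
      finally show "norm (fgm_density lam mu theta z *\<^sub>R exp (lam / 2 * fst z))
        \<le> norm (4 * (exponential_density (lam / 2) (fst z) * exponential_density mu (snd z)))"
        by (rule order_trans) (simp only: real_norm_def abs_ge_self)
    qed
  qed measurable
  then show ?thesis unfolding gain_law_def
    by (subst integrable_density) (auto simp: fgm_density_bounds)
qed

text \<open>
  For \<open>(1 - c) * (1 + a) > 1\<close> the level grows geometrically apart from the gaps, and the ruin
  probability decays exponentially in the initial level. This is needed for purely imaginary \<open>s\<close>,
  where \<open>Re (s + psi_iter a c s j beta)\<close> tends to zero.
\<close>

lemma exp_bounded_pos_lst_expanding:
  assumes "1 < (1 - c) * (1 + a)"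
  shows "\<exists>K d. 0 < d \<and> exp_bounded pos_lst K d"
proof -
  define k where "k = (1 - c) * (1 + a)"
  \<comment> \<open>Chosen so that \<open>d * (1 + a) = lam / 2\<close>: the loss caused by a gap in
    \<open>exp (- d * next_level a c x z)\<close> is then exactly the integrable weight
    \<open>exp (lam / 2 * fst z)\<close>.\<close>
  define d where "d = lam / 2 * inverse (1 + a)"
  define m where "m = (\<integral>z. exp (lam / 2 * fst z) \<partial>gain_law)"
  \<comment> \<open>Beyond \<open>x0\<close> the gain \<open>exp (- d * (k - 1) * x)\<close>
    outweighs the factor \<open>2 * m\<close>, by \<open>y <= exp y\<close>. Below \<open>x0\<close>
    the trivial bound 1 suffices, which fixes \<open>K = exp (d * x0)\<close>.\<close>
  define x0 where "x0 = 2 * m / (d * (k - 1))"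
  define K where "K = exp (d * x0)"
  have k: "1 < k" using assms by (simp add: k_def)
  have d: "0 < d" using lam_pos a_nonneg by (simp add: d_def)
  have "inverse (1 + a) * (1 + a) = 1" using a_nonneg by (intro left_inverse) simp
  then have da: "d * (1 + a) = lam / 2" unfolding d_def mult.assoc by simp
  have m: "0 \<le> m" unfolding m_def by (intro integral_nonneg_AE) auto
  have x0: "0 \<le> x0" unfolding x0_def using m d k by (intro divide_nonneg_pos) auto
  have K: "1 \<le> K" unfolding K_def using d x0 by simp
  have x0m: "2 * m * exp (- (d * (k - 1)) * x) \<le> 1" if "x0 \<le> x" for x
  proof -
    have "2 * m = d * (k - 1) * x0" using d k by (simp add: x0_def)
    also have "\<dots> \<le> d * (k - 1) * x" using that d k by (intro mult_left_mono) auto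
    also have "\<dots> \<le> exp (d * (k - 1) * x)" using exp_ge_add_one_self[of "d * (k - 1) * x"] by linarith
    finally have "2 * m * exp (- (d * (k - 1) * x)) \<le> exp (d * (k - 1) * x) * exp (- (d * (k - 1) * x))"
      by (rule mult_right_mono) simp
    then show ?thesis by (simp add: exp_minus_inverse)
  qed
  have bound: "norm (truncated_lst n x) \<le> K * exp (- d * x)" if "0 < x" for n x
    using that
  proof (induction n arbitrary: x)
    case (Suc n)
    have le1: "norm (truncated_lst (Suc n) x) \<le> 1"
      by (rule order_trans[OF norm_truncated_lst_le[OF Suc.prems]]) (use Re_s_nonneg Suc.prems in simp)
    show ?case
    proof (cases "x0 \<le> x")
      case False
      then have "1 \<le> exp (d * (x0 - x))" using d by simp
      also have "\<dots> = K * exp (- d * x)" by (simp add: K_def exp_add[symmetric] algebra_simps)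
      finally show ?thesis using le1 by simp
    next
      case True
      \<comment> \<open>In \<open>1 + K\<close> the 1 covers ruin before the first gain and the
        \<open>K\<close> covers the induction hypothesis after it.\<close>
      let ?b = "\<lambda>z. (1 + K) * exp (- (d * k * x)) * exp (lam / 2 * fst z)"
      have pt: "norm (gain_step (truncated_lst n) x z) \<le> ?b z" if z: "0 < fst z" "0 < snd z" for z
      proof (cases "(1 - c) * x \<le> fst z")
        case True
        have "norm (gain_step (truncated_lst n) x z) \<le> 1"
          using True Re_s_nonneg Suc.prems by (simp add: gain_step_def)
        also have "1 \<le> exp (lam / 2 * (fst z - (1 - c) * x))" using True lam_pos by simp
        also have "\<dots> = exp (- (d * k * x)) * exp (lam / 2 * fst z)"
          unfolding da[symmetric] k_def by (simp add: exp_add[symmetric] algebra_simps)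
        also have "\<dots> \<le> ?b z" using K by simp
        finally show ?thesis .
      next
        case False
        have nl: "0 < next_level a c x z" using False z a_nonneg by (intro next_level_pos) auto
        have le: "norm (exp (- s * of_real (c * x + fst z))) \<le> 1"
          using z Re_s_nonneg c_pos Suc.prems by simp
        have "norm (gain_step (truncated_lst n) x z)
          \<le> 1 * norm (truncated_lst n (next_level a c x z))"
          using False mult_right_mono[OF le, of "norm (truncated_lst n (next_level a c x z))"]
          by (simp only: gain_step_def if_False norm_mult norm_ge_zero)
        also have "\<dots> \<le> K * exp (- d * next_level a c x z)" using Suc.IH[OF nl] by simp
        also have "\<dots> \<le> K * exp (- (d * k * x) + lam / 2 * fst z)"
        proof -
          have "d * next_level a c x z = d * k * x - lam / 2 * fst z + d * snd z"
            unfolding da[symmetric] k_def next_level_def by (simp add: algebra_simps)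
          then have "- d * next_level a c x z \<le> - (d * k * x) + lam / 2 * fst z"
            using mult_pos_pos[OF d z(2)] by linarith
          then show ?thesis using K by simp
        qed
        also have "\<dots> \<le> ?b z" unfolding exp_add by (simp add: algebra_simps)
        finally show ?thesis .
      qed
      have "norm (truncated_lst (Suc n) x) \<le> (\<integral>z. norm (gain_step (truncated_lst n) x z) \<partial>gain_law)"
        unfolding truncated_lst_Suc[OF Suc.prems] by (rule integral_norm_bound)
      also have "\<dots> \<le> (\<integral>z. ?b z \<partial>gain_law)"
      proof (rule integral_mono_AE')
        show "integrable gain_law ?b" using integrable_exp_gap by simp
        show "AE z in gain_law. norm (gain_step (truncated_lst n) x z) \<le> ?b z"
          using AE_gain_pos by eventually_elim (blast intro: pt)
      qed (use K in simp)
      also have "\<dots> = (1 + K) * exp (- (d * k * x)) * m" by (simp add: m_def)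
      also have "\<dots> \<le> (2 * K) * exp (- (d * k * x)) * m" using K m by (intro mult_right_mono) auto
      also have "\<dots> = K * exp (- d * x) * (2 * m * exp (- (d * (k - 1)) * x))"
        by (simp add: exp_add[symmetric] algebra_simps)
      also have "\<dots> \<le> K * exp (- d * x) * 1" using K by (intro mult_left_mono x0m True) auto
      finally show ?thesis by simp
    qed
  qed (use K in simp)
  have "norm (lst x) \<le> K * exp (- d * x)" if "0 < x" for x
    using bound[OF that] by (intro LIMSEQ_le_const2[OF tendsto_norm[OF truncated_lst_tendsto[OF that]]]) blast
  then have "exp_bounded pos_lst K d" using measurable_pos_lst by (auto simp: exp_bounded_def pos_lst_def)
  then show ?thesis using d by blast
qed

section \<open>Iterates of \<open>psi\<close> and bounds on the coefficients\<close>

definition kappa :: real where "kappa = (1 - c) * (1 + a)"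

abbreviation "iter j beta \<equiv> psi_iter a c s j beta"
abbreviation "Jf \<equiv> J_tilde lam mu a c theta s"
abbreviation "tau \<equiv> laplace pos_lst"

lemma kappa_pos: "0 < kappa" using c_less_1 a_nonneg by (simp add: kappa_def)

lemma kappa_psi: "of_real kappa * psi a c s beta = beta + of_real c * s"
proof -
  have "complex_of_real (1 - c) \<noteq> 0" "complex_of_real (1 + a) \<noteq> 0"
    unfolding of_real_eq_0_iff using c_less_1 a_nonneg by auto
  then show ?thesis unfolding kappa_def psi_def rr_def of_real_mult by (simp del: of_real_add of_real_diff)
qed

lemma rr_eq_psi: "rr c s beta = of_real (1 + a) * psi a c s beta"
proof -
  have "complex_of_real (1 + a) \<noteq> 0" unfolding of_real_eq_0_iff using a_nonneg by auto
  then show ?thesis unfolding psi_def by (simp del: of_real_add)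
qed

text \<open>The two sides differ by \<open>(1 - c) * a * Re s\<close>, which is nonnegative. Hence
  the iterates never leave the half plane where the transform converges.\<close>

lemma Re_psi_ge: "Re (s + beta) \<le> kappa * Re (s + psi a c s beta)"
proof -
  have "kappa * Re (psi a c s beta) = Re beta + c * Re s"
    using arg_cong[OF kappa_psi[of beta], of Re] by simp
  moreover have "0 \<le> (1 - c) * a * Re s" using c_less_1 a_nonneg Re_s_nonneg by simp
  moreover have "kappa * Re s = Re s - c * Re s + (1 - c) * a * Re s"
    by (simp add: kappa_def algebra_simps)
  ultimately show ?thesis unfolding plus_complex.sel distrib_left by linarith
qed

lemma Re_iter_ge: "Re (s + beta) / kappa ^ j \<le> Re (s + iter j beta)"
proof (induction j)
  case (Suc j)
  have "Re (s + beta) / kappa ^ j \<le> kappa * Re (s + iter (Suc j) beta)"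
    using Suc Re_psi_ge[of "iter j beta"] by (simp add: psi_iter_Suc)
  then have "Re (s + beta) / kappa ^ j / kappa \<le> Re (s + iter (Suc j) beta)"
    unfolding pos_divide_le_eq[OF kappa_pos] by (simp only: mult.commute)
  then show ?case by (simp add: mult.commute)
qed simp

lemma Re_iter_pos: "0 < Re (s + beta) \<Longrightarrow> 0 < Re (s + iter j beta)"
  using Re_iter_ge[of beta j] kappa_pos by (meson divide_pos_pos less_le_trans zero_less_power)

lemma norm_denominators:
  assumes "0 < Re (s + beta)"
  shows "lam * (1 - c) \<le> norm (s + of_real (lam * (1 - c)) + beta)"
    and "norm (s + beta) \<le> norm (s + of_real (2 * lam * (1 - c)) + beta)"
    and "2 * lam * (1 - c) \<le> norm (s + of_real (2 * lam * (1 - c)) + beta)"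
proof -
  have p: "0 < lam * (1 - c)" using lam_pos c_less_1 by simp
  show "lam * (1 - c) \<le> norm (s + of_real (lam * (1 - c)) + beta)"
    using complex_Re_le_cmod[of "s + of_real (lam * (1 - c)) + beta"] assms by simp
  show "2 * lam * (1 - c) \<le> norm (s + of_real (2 * lam * (1 - c)) + beta)"
    using complex_Re_le_cmod[of "s + of_real (2 * lam * (1 - c)) + beta"] assms by simp
  have "(Re (s + beta))\<^sup>2 \<le> (Re (s + of_real (2 * lam * (1 - c)) + beta))\<^sup>2"
    using assms p by (intro power_mono) auto
  then show "norm (s + beta) \<le> norm (s + of_real (2 * lam * (1 - c)) + beta)"
    unfolding cmod_def by (intro real_sqrt_le_mono) simp
qed

lemma norm_coefs_le:
  assumes "0 < Re (s + beta)"
  shows "norm (coef_mu lam mu a c theta s beta) \<le> 3 * mu / (1 - c) / norm (of_real (mu * (1 + a)) - rr c s beta)"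
    and "norm (coef_2mu lam mu a c theta s beta) \<le> 3 * mu / (1 - c) / norm (of_real (2 * mu * (1 + a)) - rr c s beta)"
proof -
  define D1 where "D1 = s + of_real (lam * (1 - c)) + beta"
  define D2 where "D2 = s + of_real (2 * lam * (1 - c)) + beta"
  have p: "0 < lam * (1 - c)" using lam_pos c_less_1 by simp
  note n = norm_denominators[OF assms, folded D1_def D2_def]
  have D: "0 < norm D1" "0 < norm D2" using n p by linarith+
  have th: "\<bar>1 - theta\<bar> \<le> 2" "\<bar>theta\<bar> \<le> 1" using theta_ge theta_le by auto
  \<comment> \<open>The bound 3 collects \<open>2 * norm (s + beta)\<close> and
    \<open>2 * lam * (1 - c)\<close>, both measured by \<open>norm D2\<close>; \<open>lam\<close>
    cancels against \<open>norm D1\<close>.\<close>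
  have gen: "norm (of_real (lam * mu) * x / (D1 * D2 * E)) \<le> 3 * mu / (1 - c) / norm E"
    if "norm x \<le> 3 * norm D2" for x E :: complex
  proof -
    have "norm (of_real (lam * mu) * x / (D1 * D2 * E)) = (lam * mu) * norm x / (norm D1 * norm D2) / norm E"
      using lam_pos mu_pos by (simp add: norm_mult norm_divide)
    also have "\<dots> \<le> (lam * mu) * (3 * norm D2) / (lam * (1 - c) * norm D2) / norm E"
      using that n p D lam_pos mu_pos
      using c_less_1 by (intro divide_right_mono frac_le mult_left_mono mult_right_mono mult_nonneg_nonneg mult_pos_pos) auto
    also have "\<dots> = 3 * mu / (1 - c) / norm E" using D lam_pos by simp
    finally show ?thesis .
  qed
  have "norm ((s + beta) * of_real (1 - theta) + of_real (2 * lam * (1 - c))) \<le> norm (s + beta) * 2 + 2 * lam * (1 - c)"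
  proof (rule norm_triangle_le, rule add_mono)
    show "norm ((s + beta) * of_real (1 - theta)) \<le> norm (s + beta) * 2"
      unfolding norm_mult norm_of_real by (intro mult_left_mono th) simp
    show "norm (complex_of_real (2 * lam * (1 - c))) \<le> 2 * lam * (1 - c)"
      unfolding norm_of_real using p by simp
  qed
  also have "\<dots> \<le> 3 * norm D2" using n by linarith
  finally show "norm (coef_mu lam mu a c theta s beta) \<le> 3 * mu / (1 - c) / norm (of_real (mu * (1 + a)) - rr c s beta)"
    unfolding coef_mu_def D1_def[symmetric] D2_def[symmetric] by (rule gen)
  have "norm (2 * of_real theta * (s + beta)) \<le> 2 * 1 * norm (s + beta)"
    unfolding norm_mult norm_of_real by (intro mult_right_mono mult_mono th) auto
  also have "\<dots> \<le> 3 * norm D2" using n D by linarith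
  finally show "norm (coef_2mu lam mu a c theta s beta) \<le> 3 * mu / (1 - c) / norm (of_real (2 * mu * (1 + a)) - rr c s beta)"
    unfolding coef_2mu_def D1_def[symmetric] D2_def[symmetric] by (rule gen)
qed

lemma denominators_nonzero:
  assumes "0 < Re (s + beta)"
  shows "s + of_real (lam * (1 - c)) + beta \<noteq> 0" "s + of_real (2 * lam * (1 - c)) + beta \<noteq> 0"
proof -
  have "0 < lam * (1 - c)" using lam_pos c_less_1 by simp
  then show "s + of_real (lam * (1 - c)) + beta \<noteq> 0" "s + of_real (2 * lam * (1 - c)) + beta \<noteq> 0"
    using norm_denominators[OF assms] by auto
qed

lemma pole_factor: "of_real (m * (1 + a)) - rr c s beta = of_real (1 + a) * (of_real m - psi a c s beta)"
  unfolding rr_eq_psi by (simp add: algebra_simps)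

lemma pole_factor_nonzero: "psi a c s beta \<noteq> of_real m \<Longrightarrow> of_real (m * (1 + a)) - rr c s beta \<noteq> 0"
  unfolding pole_factor mult_eq_0_iff of_real_eq_0_iff using a_nonneg by auto

lemma J_eq_coefs:
  assumes "0 < Re (s + beta)" "psi a c s beta \<noteq> of_real mu" "psi a c s beta \<noteq> of_real (2 * mu)"
  shows "Jf beta = coef_mu lam mu a c theta s beta + coef_2mu lam mu a c theta s beta"
  by (intro J_tilde_eq_coefs denominators_nonzero pole_factor_nonzero assms)

text \<open>
  The two denominators \<open>mu * (1 + a) - rr c s beta\<close> and \<open>2 * mu * (1 + a) - rr c s beta\<close> differ by
  \<open>mu * (1 + a)\<close>, so they are not both small; the coefficient with the small one is controlled by
  the sum \<open>J_tilde\<close> of both coefficients.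
\<close>

lemma norm_coefs_le_J:
  assumes "0 < Re (s + beta)" "psi a c s beta \<noteq> of_real mu" "psi a c s beta \<noteq> of_real (2 * mu)"
  shows "norm (coef_mu lam mu a c theta s beta) \<le> 6 / ((1 - c) * (1 + a)) + norm (Jf beta)"
    and "norm (coef_2mu lam mu a c theta s beta) \<le> 6 / ((1 - c) * (1 + a)) + norm (Jf beta)"
proof -
  define E1 where "E1 = of_real (mu * (1 + a)) - rr c s beta"
  define E2 where "E2 = of_real (2 * mu * (1 + a)) - rr c s beta"
  define P where "P = coef_mu lam mu a c theta s beta"
  define Q where "Q = coef_2mu lam mu a c theta s beta"
  let ?w = "mu * (1 + a)" and ?K = "6 / ((1 - c) * (1 + a))"
  have w: "0 < ?w" using mu_pos a_nonneg by simp
  have J: "Jf beta = P + Q" unfolding P_def Q_def by (rule J_eq_coefs[OF assms])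
  \<comment> \<open>At distance at least \<open>mu * (1 + a) / 2\<close> from the pole the bound of
    \<open>norm_coefs_le\<close> becomes the constant \<open>?K\<close>.\<close>
  have K: "3 * mu / (1 - c) / e \<le> ?K" if "?w / 2 \<le> e" for e
  proof -
    have "3 * mu / (1 - c) / e \<le> 3 * mu / (1 - c) / (?w / 2)"
      using that w mu_pos c_less_1 by (intro divide_left_mono mult_pos_pos) auto
    also have "\<dots> = ?K" using mu_pos by simp
    finally show ?thesis .
  qed
  note n = norm_coefs_le[OF assms(1), folded E1_def E2_def P_def Q_def]
  have "E2 = E1 + of_real ?w" by (simp add: E1_def E2_def algebra_simps)
  then have "?w = norm (E2 - E1)" using w by (simp del: of_real_mult)
  also have "\<dots> \<le> norm E2 + norm E1" by (rule norm_triangle_ineq4)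
  finally have "?w / 2 \<le> norm E1 \<or> ?w / 2 \<le> norm E2" by linarith
  then have "norm P \<le> ?K \<or> norm Q \<le> ?K" using n K order_trans by blast
  moreover have "norm P \<le> norm (Jf beta) + norm Q" "norm Q \<le> norm (Jf beta) + norm P"
    using norm_triangle_ineq4[of "P + Q" Q] norm_triangle_ineq4[of "P + Q" P] unfolding J by auto
  moreover have "0 \<le> norm (Jf beta)" by simp
  ultimately show "norm (coef_mu lam mu a c theta s beta) \<le> ?K + norm (Jf beta)"
    "norm (coef_2mu lam mu a c theta s beta) \<le> ?K + norm (Jf beta)"
    unfolding P_def[symmetric] Q_def[symmetric] by auto
qed

lemma tau_functional_equation:
  assumes "0 < Re (s + beta)" "psi a c s beta \<noteq> of_real mu" "psi a c s beta \<noteq> of_real (2 * mu)"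
  shows "tau beta = Jf beta * tau (psi a c s beta)
     + H_tilde lam mu a c theta (tau (of_real mu)) (tau (of_real (2 * mu))) s beta"
proof -
  define D1 where "D1 = s + of_real (lam * (1 - c)) + beta"
  define D2 where "D2 = s + of_real (2 * lam * (1 - c)) + beta"
  define E1 where "E1 = of_real (mu * (1 + a)) - rr c s beta"
  define E2 where "E2 = of_real (2 * mu * (1 + a)) - rr c s beta"
  define dm where "dm = tau (psi a c s beta) - tau (of_real mu)"
  define dn where "dn = tau (psi a c s beta) - tau (of_real (2 * mu))"
  define P where "P = coef_mu lam mu a c theta s beta"
  define Q where "Q = coef_2mu lam mu a c theta s beta"
  have ac: "s + beta + of_real z = s + of_real z + beta" for z by simp
  have nz: "D1 \<noteq> 0" "D2 \<noteq> 0"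
    unfolding D1_def D2_def by (intro denominators_nonzero assms)+
  have D: "D1 = (s + beta) + of_real (lam * (1 - c))" "D2 = (s + beta) + 2 * of_real (lam * (1 - c))"
    by (simp_all add: D1_def D2_def)
  have P: "P = (of_real lam * of_real mu) * ((s + beta) * (1 - of_real theta) + 2 * of_real (lam * (1 - c))) / (D1 * D2 * E1)"
    unfolding P_def coef_mu_def D1_def[symmetric] D2_def[symmetric] E1_def[symmetric] by simp
  have Q: "Q = (of_real lam * of_real mu) * (2 * of_real theta * (s + beta)) / (D1 * D2 * E2)"
    unfolding Q_def coef_2mu_def D1_def[symmetric] D2_def[symmetric] E2_def[symmetric] by simp
  have "tau beta = 1 / D1 + ((1 + of_real theta) * (of_real lam / D1 * of_real mu / E1 * dm)
      - of_real theta * (2 * of_real lam / D2 * of_real mu / E1 * dm)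
      - of_real theta * (of_real lam / D1 * (2 * of_real mu) / E2 * dn)
      + of_real theta * (2 * of_real lam / D2 * (2 * of_real mu) / E2 * dn))"
    using laplace_pos_lst_equation[OF assms, unfolded ac, folded D1_def D2_def E1_def E2_def dm_def dn_def]
    by simp
  also have "\<dots> = 1 / D1 + (P * dm + Q * dn)"
    unfolding P Q by (rule arg_cong[where f="\<lambda>y. 1 / D1 + y"], rule coefs_collect[OF nz D])
  finally have "tau beta = 1 / D1 + P * dm + Q * dn" by (simp add: add.assoc)
  then show ?thesis
    unfolding J_eq_coefs[OF assms] H_tilde_eq_coefs P_def[symmetric] Q_def[symmetric] D1_def[symmetric] dm_def dn_def
    by (simp add: algebra_simps)
qed

lemma no_pole_psi:
  assumes "no_pole mu a c s beta"
  shows "psi a c s (iter j beta) \<noteq> of_real mu" "psi a c s (iter j beta) \<noteq> of_real (2 * mu)"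
  using assms psi_iter_Suc[of a c s j beta] by (auto simp: no_pole_def)

section \<open>Asymptotics of the iterates, of the factors and of the transform along them\<close>

lemma iter_fixed_point:
  assumes "kappa \<noteq> 1"
  defines "f \<equiv> of_real c * s / of_real (kappa - 1)"
  shows "iter j beta = f + (beta - f) / of_real kappa ^ j"
proof (induction j)
  case (Suc j)
  have k: "complex_of_real kappa \<noteq> 0" "complex_of_real (kappa - 1) \<noteq> 0"
    using kappa_pos assms(1) unfolding of_real_eq_0_iff by auto
  have "of_real (kappa - 1) * f = of_real c * s" using k(2) by (simp add: f_def del: of_real_diff)
  then have f: "f + of_real c * s = of_real kappa * f" by (simp add: algebra_simps)
  have "of_real kappa * iter (Suc j) beta = (f + of_real c * s) + (beta - f) / of_real kappa ^ j"
    unfolding psi_iter_Suc kappa_psi Suc by simp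
  also have "\<dots> = of_real kappa * (f + (beta - f) / of_real kappa ^ Suc j)"
    unfolding f using k(1) by (simp add: distrib_left)
  finally show ?case using k(1) by simp
qed simp

lemma iter_kappa_1:
  assumes "kappa = 1"
  shows "iter j beta = beta + of_nat j * (of_real c * s)"
proof (induction j)
  case (Suc j)
  have "iter (Suc j) beta = iter j beta + of_real c * s"
    using kappa_psi[of "iter j beta"] assms by (simp add: psi_iter_Suc)
  then show ?case using Suc by (simp add: algebra_simps)
qed simp

lemma iter_tendsto:
  assumes "1 < kappa"
  shows "(\<lambda>j. iter j beta) \<longlonglongrightarrow> of_real c * s / of_real (kappa - 1)"
proof -
  let ?f = "of_real c * s / of_real (kappa - 1)"
  have "(\<lambda>j. ?f + (beta - ?f) * (inverse (of_real kappa)) ^ j) \<longlonglongrightarrow> ?f + (beta - ?f) * 0"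
    using assms by (intro tendsto_intros LIMSEQ_power_zero) (simp add: norm_inverse inverse_less_1_iff)
  then show ?thesis using assms by (simp add: iter_fixed_point divide_inverse power_inverse)
qed

text \<open>For \<open>kappa < 1\<close> the real parts grow geometrically. For
  \<open>kappa = 1\<close> each step adds \<open>c * s\<close>, and \<open>s = 0\<close> would give
  a constant sequence. For \<open>kappa > 1\<close> the sequence converges, so divergence leaves
  only the first two cases.\<close>

lemma norm_iter_at_top:
  assumes "\<not> convergent (\<lambda>j. iter j beta)" "0 < Re (s + beta)"
  shows "filterlim (\<lambda>j. norm (iter j beta)) at_top sequentially"
proof -
  consider "kappa < 1" | "kappa = 1" | "1 < kappa" by linarith
  then show ?thesis
  proof cases
    case 1
    have "filterlim (\<lambda>j. inverse (kappa ^ j)) at_top sequentially"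
      using 1 kappa_pos
      by (intro filterlim_inverse_at_top LIMSEQ_power_zero) (auto simp: eventually_sequentially)
    then have "filterlim (\<lambda>j. - Re s + Re (s + beta) * inverse (kappa ^ j)) at_top sequentially"
      using assms(2) by (intro filterlim_tendsto_add_at_top[OF tendsto_const]
          filterlim_tendsto_pos_mult_at_top[OF tendsto_const])
    then show ?thesis
    proof (rule filterlim_at_top_mono)
      have "- Re s + Re (s + beta) * inverse (kappa ^ j) \<le> norm (iter j beta)" for j
        using Re_iter_ge[of beta j] complex_Re_le_cmod[of "iter j beta"] by (simp add: divide_inverse)
      then show "eventually (\<lambda>j. - Re s + Re (s + beta) * inverse (kappa ^ j) \<le> norm (iter j beta)) sequentially"
        by simp
    qed
  next
    case 2
    have s: "s \<noteq> 0"
    proof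
      assume "s = 0"
      then have "(\<lambda>j. iter j beta) = (\<lambda>j. beta)" using iter_kappa_1[OF 2] by auto
      then show False using assms(1) by (simp add: convergent_const)
    qed
    have "filterlim (\<lambda>j. - norm beta + (c * norm s) * real j) at_top sequentially"
      using c_pos s by (intro filterlim_tendsto_add_at_top[OF tendsto_const]
          filterlim_tendsto_pos_mult_at_top[OF tendsto_const] filterlim_real_sequentially) simp
    then show ?thesis
    proof (rule filterlim_at_top_mono)
      have "- norm beta + (c * norm s) * real j \<le> norm (iter j beta)" for j
        using norm_diff_ineq[of "of_nat j * (of_real c * s)" beta] c_pos
        unfolding iter_kappa_1[OF 2] by (simp add: norm_mult add.commute mult.commute)
      then show "eventually (\<lambda>j. - norm beta + (c * norm s) * real j \<le> norm (iter j beta)) sequentially"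
        by simp
    qed
  next
    case 3
    then have "convergent (\<lambda>j. iter j beta)" using iter_tendsto convergentI by blast
    then show ?thesis using assms(1) by simp
  qed
qed

lemma J_eventually_small:
  assumes pos: "0 < Re (s + beta)" and np: "no_pole mu a c s beta"
    and ctr: "factors_contract lam mu a c theta s beta" and nz: "\<And>j. Jf (iter j beta) \<noteq> 0"
  shows "\<exists>r<1. eventually (\<lambda>j. norm (Jf (iter j beta)) \<le> r) sequentially"
proof (cases "convergent (\<lambda>j. iter j beta)")
  case True
  then obtain l where l: "l < 1" "(\<lambda>j. norm (Jf (iter j beta))) \<longlonglongrightarrow> l"
    using ctr nz unfolding factors_contract_def by blast
  \<comment> \<open>The midpoint between \<open>l\<close> and 1 is a uniform bound that stays below
    1.\<close>
  have "eventually (\<lambda>j. norm (Jf (iter j beta)) < (l + 1) / 2) sequentially"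
    using l by (intro order_tendstoD(2)[OF l(2)]) simp
  then have "eventually (\<lambda>j. norm (Jf (iter j beta)) \<le> (l + 1) / 2) sequentially"
    by eventually_elim simp
  moreover have "(l + 1) / 2 < 1" using l by simp
  ultimately show ?thesis by blast
next
  case False
  let ?K = "3 * mu / (1 - c)"
  have K: "0 < ?K" using mu_pos c_less_1 by simp
  let ?g = "\<lambda>m j. norm (of_real (m * (1 + a)) - rr c s (iter j beta))"
  have E: "filterlim (?g m) at_top sequentially" for m
  proof (rule filterlim_at_top_mono)
    have "filterlim (\<lambda>j. norm (iter (Suc j) beta)) at_top sequentially"
      using norm_iter_at_top[OF False pos] by (subst filterlim_sequentially_Suc)
    then show "filterlim (\<lambda>j. - \<bar>m\<bar> + norm (iter (Suc j) beta)) at_top sequentially"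
      by (intro filterlim_tendsto_add_at_top[OF tendsto_const])
    have "- \<bar>m\<bar> + norm (iter (Suc j) beta) \<le> ?g m j" for j
    proof -
      have "- \<bar>m\<bar> + norm (iter (Suc j) beta) \<le> norm (of_real m - iter (Suc j) beta)"
        using norm_triangle_ineq2[of "iter (Suc j) beta" "of_real m"] by (simp add: norm_minus_commute)
      also have "\<dots> \<le> (1 + a) * norm (of_real m - iter (Suc j) beta)"
        using a_nonneg mult_right_mono[of 1 "1 + a" "norm (of_real m - iter (Suc j) beta)"] by simp
      also have "\<dots> = ?g m j"
        unfolding pole_factor psi_iter_Suc norm_mult norm_of_real using a_nonneg by simp
      finally show ?thesis .
    qed
    then show "eventually (\<lambda>j. - \<bar>m\<bar> + norm (iter (Suc j) beta) \<le> ?g m j) sequentially" by simp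
  qed
  \<comment> \<open>With denominators of norm at least \<open>4 * ?K\<close> each of the two
    coefficients is at most 1/4, so their sum is at most 1/2.\<close>
  have "eventually (\<lambda>j. 4 * ?K \<le> ?g m j) sequentially" for m
    using E[of m] unfolding filterlim_at_top by blast
  from this[of mu] this[of "2 * mu"]
  have "eventually (\<lambda>j. norm (Jf (iter j beta)) \<le> 1 / 2) sequentially"
  proof eventually_elim
    case (elim j)
    have "k / e \<le> 1 / 4" if "4 * k \<le> e" "0 < k" for k e :: real
      using that by (simp add: pos_divide_le_eq)
    note q = this[OF _ K]
    have "norm (Jf (iter j beta)) \<le> 1 / 4 + 1 / 4"
      unfolding J_eq_coefs[OF Re_iter_pos[OF pos] no_pole_psi[OF np]]
      using norm_coefs_le[OF Re_iter_pos[OF pos], of j] q[OF elim(1)] q[OF elim(2)]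
      by (intro norm_triangle_le add_mono) linarith+
    then show ?case by simp
  qed
  then show ?thesis by (intro exI[of _ "1 / 2"]) simp
qed

text \<open>For \<open>kappa <= 1\<close> the quantity \<open>Re (s + iter j beta)\<close> does not
  drop below its initial value. For \<open>kappa > 1\<close> the iterates converge to a point with
  nonnegative real part, possibly 0, and the strict decay of \<open>pos_lst\<close> at rate
  \<open>d\<close> leaves a margin of \<open>d / 2\<close>.\<close>

lemma tau_iter_bounded:
  assumes pos: "0 < Re (s + beta)"
  shows "\<exists>K. eventually (\<lambda>j. norm (tau (iter j beta)) \<le> K) sequentially"
proof (cases "kappa \<le> 1")
  case True
  have "norm (tau (iter j beta)) \<le> 1 / Re (s + beta)" for j
  proof -
    have "Re (s + beta) \<le> Re (s + beta) / kappa ^ j"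
      using pos kappa_pos power_le_one[of kappa j] True
      by (simp add: pos_le_divide_eq mult_left_le del: plus_complex.sel)
    also have "\<dots> \<le> Re (s + iter j beta)" by (rule Re_iter_ge)
    finally have le: "Re (s + beta) \<le> Re (s + iter j beta)" .
    then have "norm (tau (iter j beta)) \<le> 1 / Re (s + iter j beta)"
      using exp_bounded_integrable(2)[OF exp_bounded_pos_lst, of "iter j beta"] pos by (simp add: add.commute)
    also have "\<dots> \<le> 1 / Re (s + beta)" using le pos by (intro divide_left_mono) auto
    finally show ?thesis .
  qed
  then show ?thesis by (intro exI[of _ "1 / Re (s + beta)"]) simp
next
  case False
  then have k: "1 < kappa" by simp
  then obtain K d where d: "0 < d" "exp_bounded pos_lst K d"
    using exp_bounded_pos_lst_expanding by (auto simp: kappa_def)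
  let ?f = "of_real c * s / of_real (kappa - 1)"
  have "(\<lambda>j. Re (iter j beta)) \<longlonglongrightarrow> Re ?f" by (intro tendsto_Re iter_tendsto k)
  moreover have "0 \<le> Re ?f"
    unfolding Re_divide_of_real using c_pos Re_s_nonneg k by (intro divide_nonneg_pos) auto
  ultimately have "eventually (\<lambda>j. - d / 2 < Re (iter j beta)) sequentially"
    using d(1) by (intro order_tendstoD(1)) auto
  then have "eventually (\<lambda>j. norm (tau (iter j beta)) \<le> K / (d / 2)) sequentially"
  proof eventually_elim
    case (elim j)
    then have "norm (tau (iter j beta)) \<le> K / (Re (iter j beta) + d)"
      using d by (intro exp_bounded_integrable(2)[OF d(2)]) simp
    also have "\<dots> \<le> K / (d / 2)"
      using elim d(1) exp_bounded_nonneg[OF d(2)] by (intro divide_left_mono mult_pos_pos) auto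
    finally show ?case .
  qed
  then show ?thesis by blast
qed

section \<open>Summation of the series and the linear system for the unknowns\<close>

definition admissible :: "complex \<Rightarrow> bool" where
  "admissible beta \<longleftrightarrow> 0 < Re (s + beta) \<and> no_pole mu a c s beta \<and> factors_contract lam mu a c theta s beta"

text \<open>The bound on \<open>h\<close> may depend on an eventual bound \<open>r\<close> for the
  factors. This is what \<open>norm_coefs_le_J\<close> offers: the coefficients are controlled only
  as far as \<open>J_tilde\<close> is.\<close>

lemma summable_iter_prod:
  assumes "admissible beta"
    and "\<And>r. r < 1 \<Longrightarrow> eventually (\<lambda>j. norm (Jf (iter j beta)) \<le> r) sequentially
      \<Longrightarrow> \<exists>K. eventually (\<lambda>j. norm (h (iter j beta)) \<le> K) sequentially"
  shows "summable (\<lambda>k. (\<Prod>j<k. Jf (iter j beta)) * h (iter k beta))"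
proof (cases "\<exists>j. Jf (iter j beta) = 0")
  case True
  then show ?thesis by (intro summable_prod_mult) blast
next
  case False
  then obtain r where r: "r < 1" "eventually (\<lambda>j. norm (Jf (iter j beta)) \<le> r) sequentially"
    using J_eventually_small assms(1) unfolding admissible_def by blast
  with assms(2)[OF r] obtain K where "eventually (\<lambda>j. norm (h (iter j beta)) \<le> K) sequentially" by blast
  with r show ?thesis by (intro summable_prod_mult) blast
qed

text \<open>\<open>no_pole\<close> forbids the iterates from hitting \<open>mu\<close> or
  \<open>2 * mu\<close>, not from converging there. Boundedness of the coefficients therefore comes
  from the eventual bound on the factors instead of a distance to the poles.\<close>

lemma summable_coefs:
  assumes "admissible beta"
  shows "summable (\<lambda>k. (\<Prod>j<k. Jf (iter j beta)) * (1 / (s + of_real (lam * (1 - c)) + iter k beta)))"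
    and "summable (\<lambda>k. (\<Prod>j<k. Jf (iter j beta)) * coef_mu lam mu a c theta s (iter k beta))"
    and "summable (\<lambda>k. (\<Prod>j<k. Jf (iter j beta)) * coef_2mu lam mu a c theta s (iter k beta))"
proof -
  have pos: "0 < Re (s + iter k beta)" for k using assms by (intro Re_iter_pos) (simp add: admissible_def)
  note np = no_pole_psi[of beta]
  have np': "no_pole mu a c s beta" using assms by (simp add: admissible_def)
  have p: "0 < lam * (1 - c)" using lam_pos c_less_1 by simp
  show "summable (\<lambda>k. (\<Prod>j<k. Jf (iter j beta)) * (1 / (s + of_real (lam * (1 - c)) + iter k beta)))"
  proof (rule summable_iter_prod[OF assms, of "\<lambda>b. 1 / (s + of_real (lam * (1 - c)) + b)"], goal_cases)
    case 1
    have "norm (1 / (s + of_real (lam * (1 - c)) + iter k beta)) \<le> 1 / (lam * (1 - c))" for k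
      using norm_denominators(1)[OF pos, of k] p unfolding norm_divide norm_one
      by (intro frac_le) simp_all
    then show ?case by (intro exI[of _ "1 / (lam * (1 - c))"]) simp
  qed
  show "summable (\<lambda>k. (\<Prod>j<k. Jf (iter j beta)) * coef_mu lam mu a c theta s (iter k beta))"
  proof (rule summable_iter_prod[OF assms, of "coef_mu lam mu a c theta s"], goal_cases)
    case (1 r)
    from 1(2) have "eventually (\<lambda>j. norm (coef_mu lam mu a c theta s (iter j beta)) \<le> 6 / ((1 - c) * (1 + a)) + r) sequentially"
      by eventually_elim (use norm_coefs_le_J(1)[OF pos np[OF np']] in \<open>smt (verit)\<close>)
    then show ?case by blast
  qed
  show "summable (\<lambda>k. (\<Prod>j<k. Jf (iter j beta)) * coef_2mu lam mu a c theta s (iter k beta))"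
  proof (rule summable_iter_prod[OF assms, of "coef_2mu lam mu a c theta s"], goal_cases)
    case (1 r)
    from 1(2) have "eventually (\<lambda>j. norm (coef_2mu lam mu a c theta s (iter j beta)) \<le> 6 / ((1 - c) * (1 + a)) + r) sequentially"
      by eventually_elim (use norm_coefs_le_J(2)[OF pos np[OF np']] in \<open>smt (verit)\<close>)
    then show ?case by blast
  qed
qed

lemma tau_partial_sums:
  assumes "0 < Re (s + beta)" "no_pole mu a c s beta"
  shows "tau beta = (\<Sum>k<n. (\<Prod>j<k. Jf (iter j beta))
       * H_tilde lam mu a c theta (tau (of_real mu)) (tau (of_real (2 * mu))) s (iter k beta))
     + (\<Prod>j<n. Jf (iter j beta)) * tau (iter n beta)"
proof (induction n)
  case (Suc n)
  have "tau (iter n beta) = Jf (iter n beta) * tau (iter (Suc n) beta)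
      + H_tilde lam mu a c theta (tau (of_real mu)) (tau (of_real (2 * mu))) s (iter n beta)"
    unfolding psi_iter_Suc
    by (rule tau_functional_equation[OF Re_iter_pos[OF assms(1)] no_pole_psi[OF assms(2)]])
  then have "(\<Prod>j<n. Jf (iter j beta)) * tau (iter n beta)
     = (\<Prod>j<n. Jf (iter j beta)) * H_tilde lam mu a c theta (tau (of_real mu)) (tau (of_real (2 * mu))) s (iter n beta)
       + (\<Prod>j<Suc n. Jf (iter j beta)) * tau (iter (Suc n) beta)"
    by (simp add: distrib_left mult.assoc)
  with Suc show ?case by simp
qed simp

lemma tau_series:
  assumes "admissible beta"
  shows "series_term lam mu a c theta (tau (of_real mu)) (tau (of_real (2 * mu))) s beta sums tau beta"
proof -
  let ?t = "series_term lam mu a c theta (tau (of_real mu)) (tau (of_real (2 * mu))) s beta"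
  have pos: "0 < Re (s + beta)" and np: "no_pole mu a c s beta"
    using assms by (auto simp: admissible_def)
  \<comment> \<open>The remainder after \<open>n\<close> steps is itself the general term of such a
    series, with the transform in the place of \<open>h\<close>; hence it tends to 0.\<close>
  have "summable (\<lambda>k. (\<Prod>j<k. Jf (iter j beta)) * tau (iter k beta))"
    using tau_iter_bounded[OF pos] by (intro summable_iter_prod[OF assms])
  then have "(\<lambda>n. (\<Prod>j<n. Jf (iter j beta)) * tau (iter n beta)) \<longlonglongrightarrow> 0"
    by (rule summable_LIMSEQ_zero)
  then have "(\<lambda>n. tau beta - (\<Prod>j<n. Jf (iter j beta)) * tau (iter n beta)) \<longlonglongrightarrow> tau beta - 0"
    by (intro tendsto_diff tendsto_const)
  moreover have "tau beta - (\<Prod>j<n. Jf (iter j beta)) * tau (iter n beta) = (\<Sum>k<n. ?t k)" for n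
    using tau_partial_sums[OF pos np, of n] unfolding series_term_def
    by (metis (no_types, lifting) add_diff_cancel_right')
  ultimately show ?thesis unfolding sums_def by simp
qed

lemma series_term_affine:
  "series_term lam mu a c theta u v s beta k
     = (\<Prod>j<k. Jf (iter j beta)) * (1 / (s + of_real (lam * (1 - c)) + iter k beta))
       - (\<Prod>j<k. Jf (iter j beta)) * coef_mu lam mu a c theta s (iter k beta) * u
       - (\<Prod>j<k. Jf (iter j beta)) * coef_2mu lam mu a c theta s (iter k beta) * v"
  unfolding series_term_def H_tilde_eq_coefs by (simp add: right_diff_distrib mult.assoc)

lemma series_affine:
  assumes "admissible beta"
  shows "\<exists>x y z. \<forall>u v. series_term lam mu a c theta u v s beta sums (x + y * u + z * v)"
proof -
  note S = summable_coefs[OF assms, THEN summable_sums]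
  show ?thesis
  proof (intro exI allI)
    fix u v
    show "series_term lam mu a c theta u v s beta sums
      ((\<Sum>k. (\<Prod>j<k. Jf (iter j beta)) * (1 / (s + of_real (lam * (1 - c)) + iter k beta)))
        + (- (\<Sum>k. (\<Prod>j<k. Jf (iter j beta)) * coef_mu lam mu a c theta s (iter k beta))) * u
        + (- (\<Sum>k. (\<Prod>j<k. Jf (iter j beta)) * coef_2mu lam mu a c theta s (iter k beta))) * v)"
      using sums_diff[OF sums_diff[OF S(1) sums_mult2[OF S(2), of u]] sums_mult2[OF S(3), of v]]
      unfolding series_term_affine by simp
  qed
qed

lemma system_unique:
  assumes adm: "admissible (of_real mu)" "admissible (of_real (2 * mu))"
    and det: "system_det lam mu a c theta s \<noteq> 0"
    and uv: "series_term lam mu a c theta u v s (of_real mu) sums u"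
      "series_term lam mu a c theta u v s (of_real (2 * mu)) sums v"
    and uv': "series_term lam mu a c theta u' v' s (of_real mu) sums u'"
      "series_term lam mu a c theta u' v' s (of_real (2 * mu)) sums v'"
  shows "u = u' \<and> v = v'"
proof -
  obtain x y z where p: "\<And>u v. series_term lam mu a c theta u v s (of_real mu) sums (x + y * u + z * v)"
    using series_affine[OF adm(1)] by blast
  obtain x' y' z' where q: "\<And>u v. series_term lam mu a c theta u v s (of_real (2 * mu)) sums (x' + y' * u + z' * v)"
    using series_affine[OF adm(2)] by blast
  have F: "series_sum lam mu a c theta u v s (of_real mu) = x + y * u + z * v"
    "series_sum lam mu a c theta u v s (of_real (2 * mu)) = x' + y' * u + z' * v" for u v
    unfolding series_sum_def using p q by (auto intro: sums_unique[symmetric])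
  \<comment> \<open>The values at \<open>(0, 0)\<close>, \<open>(1, 0)\<close> and
    \<open>(0, 1)\<close> recover the slopes \<open>y\<close>, \<open>z\<close>, \<open>y'\<close>,
    \<open>z'\<close>, so \<open>system_det\<close> is the determinant of the system.\<close>
  have det': "(1 - y) * (1 - z') - z * y' \<noteq> 0"
    using det unfolding system_det_def Let_def F by simp
  have "u = x + y * u + z * v" "u' = x + y * u' + z * v'" "v = x' + y' * u + z' * v" "v' = x' + y' * u' + z' * v'"
    using sums_unique2[OF uv(1) p] sums_unique2[OF uv'(1) p] sums_unique2[OF uv(2) q] sums_unique2[OF uv'(2) q]
    by auto
  then have e: "(1 - y) * (u - u') = z * (v - v')" "(1 - z') * (v - v') = y' * (u - u')"
    by (simp_all add: algebra_simps) (metis (no_types, lifting) add.assoc add.commute)+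
  \<comment> \<open>Cramer's rule for the homogeneous system satisfied by the difference of the two
    solutions.\<close>
  have "((1 - y) * (1 - z') - z * y') * (u - u') = (1 - z') * ((1 - y) * (u - u')) - z * (y' * (u - u'))"
    by (simp add: algebra_simps)
  also have "\<dots> = 0" unfolding e(1) e(2)[symmetric] by (simp add: algebra_simps)
  finally have u: "u = u'" using det' by simp
  have "((1 - y) * (1 - z') - z * y') * (v - v') = (1 - y) * ((1 - z') * (v - v')) - y' * (z * (v - v'))"
    by (simp add: algebra_simps)
  also have "\<dots> = 0" unfolding e(2) e(1)[symmetric] by (simp add: algebra_simps)
  finally have "v = v'" using det' by simp
  with u show ?thesis by simp
qed

end

theorem theorem13:
  fixes M :: "'w measure"
    and B C :: "nat \<Rightarrow> 'w \<Rightarrow> real"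
    and lam mu a c theta :: real
    and s :: complex
  assumes "prob_space M"
    and "prob_space.indep_vars M (\<lambda>_. borel) (\<lambda>n w. (B n w, C n w)) UNIV"
    and "\<And>n. distributed M (lborel \<Otimes>\<^sub>M lborel) (\<lambda>w. (B n w, C n w))
               (\<lambda>z. ennreal (fgm_density lam mu theta z))"
    and "0 < lam" and "0 < mu" and "0 \<le> a" and "0 < c" and "c < 1"
    and "- 1 \<le> theta" and "theta \<le> 1"
    and "0 \<le> Re s"
  defines "tau \<equiv> ruin_tau M B C a c s"
  defines "p \<equiv> complex_of_real mu" and "q \<equiv> complex_of_real (2 * mu)"
  shows "(\<forall>beta. 0 < Re (s + beta) \<and> no_pole mu a c s beta
              \<and> factors_contract lam mu a c theta s beta
            \<longrightarrow> (\<lambda>k. (\<Prod>j<k. J_tilde lam mu a c theta s (psi_iter a c s j beta))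
                    * H_tilde lam mu a c theta (tau p) (tau q) s (psi_iter a c s k beta))
                 sums tau beta)
       \<and> (no_pole mu a c s p \<and> factors_contract lam mu a c theta s p
            \<and> no_pole mu a c s q \<and> factors_contract lam mu a c theta s q
            \<longrightarrow> series_term lam mu a c theta (tau p) (tau q) s p sums tau p
              \<and> series_term lam mu a c theta (tau p) (tau q) s q sums tau q
              \<and> (system_det lam mu a c theta s \<noteq> 0
                  \<longrightarrow> (\<forall>u v. series_term lam mu a c theta u v s p sums u
                           \<and> series_term lam mu a c theta u v s q sums v
                           \<longrightarrow> u = tau p \<and> v = tau q)))"
proof -
  interpret risk: fgm_dual_risk M B C lam mu a c theta s
    using assms(1-11) by (simp add: fgm_dual_risk_def fgm_dual_risk_axioms_def)
  have tau: "tau = laplace risk.pos_lst"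
    unfolding tau_def by (rule ext) (rule risk.ruin_tau_eq_laplace)
  \<comment> \<open>Positivity of \<open>mu\<close> puts both evaluation points into the half plane
    of convergence, even for purely imaginary \<open>s\<close>.\<close>
  have pq: "0 < Re (s + p)" "0 < Re (s + q)"
    using assms(5,11) by (simp_all add: p_def q_def)
  have series: "series_term lam mu a c theta (tau p) (tau q) s beta sums tau beta"
    if "0 < Re (s + beta)" "no_pole mu a c s beta" "factors_contract lam mu a c theta s beta" for beta
    unfolding tau p_def q_def by (rule risk.tau_series) (use that in \<open>simp add: risk.admissible_def\<close>)
  show ?thesis
  proof (intro conjI allI impI; (elim conjE)?)
    fix beta
    assume "0 < Re (s + beta)" "no_pole mu a c s beta" "factors_contract lam mu a c theta s beta"
    then show "(\<lambda>k. (\<Prod>j<k. J_tilde lam mu a c theta s (psi_iter a c s j beta))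
                    * H_tilde lam mu a c theta (tau p) (tau q) s (psi_iter a c s k beta))
                 sums tau beta"
      using series unfolding series_term_def by blast
  next
    assume p: "no_pole mu a c s p" "factors_contract lam mu a c theta s p"
      and q: "no_pole mu a c s q" "factors_contract lam mu a c theta s q"
    show sp: "series_term lam mu a c theta (tau p) (tau q) s p sums tau p" using series[OF pq(1) p] .
    show sq: "series_term lam mu a c theta (tau p) (tau q) s q sums tau q" using series[OF pq(2) q] .
    fix u v
    assume det: "system_det lam mu a c theta s \<noteq> 0"
      and uv: "series_term lam mu a c theta u v s p sums u" "series_term lam mu a c theta u v s q sums v"
    have "risk.admissible p" "risk.admissible q"
      using p q pq by (simp_all add: risk.admissible_def)
    from risk.system_unique[OF this[unfolded p_def q_def] det uv[unfolded p_def q_def] sp[unfolded p_def q_def] sq[unfolded p_def q_def]]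
    show "u = tau p" "v = tau q" by (simp_all add: p_def q_def)
  qed
qed

end
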